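(* Let $\omega(s)$ be the meromorphic continuation to $\mathbb{C}$ of the Dirichlet series $\sum_{j,k=1}^\infty \big(jk(j+k)\big)^{-s}$ (convergent for $\mathrm{Re}(s)>2/3$). Then $\omega$ is holomorphic at the nonpositive integers and $$\omega(0)=\tfrac13,\qquad \omega(-n)=0\quad(n=1,2,3,\ldots).$$ *)

theory Defs
  imports "HOL-Complex_Analysis.Complex_Analysis"
begin

definition omega_term :: "complex \<Rightarrow> nat \<times> nat \<Rightarrow> complex" where
  "omega_term s = (\<lambda>(j, k). of_nat (j * k * (j + k)) powr (- s))"

definition omega_series :: "complex \<Rightarrow> complex" where
  "omega_series s = (\<Sum>\<^sub>\<infinity>p \<in> {1..} \<times> {1..}. omega_term s p)"

text \<open>
  The predicate \<open>nicely_meromorphic_on\<close> is used instead of \<open>meromorphic_on\<close>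
  because the latter allows arbitrary values at isolated points. Here a function takes its limit
  value wherever it has no pole (and the dummy value 0 at poles), so that its values are
  determined by the series.
\<close>

definition is_omega :: "(complex \<Rightarrow> complex) \<Rightarrow> bool" where
  "is_omega \<omega> \<longleftrightarrow>
     \<omega> nicely_meromorphic_on UNIV \<and> (\<forall>s. Re s > 2 / 3 \<longrightarrow> \<omega> s = omega_series s)"

end

theory Submission
  imports Defs
begin

text \<open>
  Write \<open>L s x\<close> for the sum of \<open>k powr (-s) * exp (-k x)\<close> over \<open>k \<ge> 1\<close>. Then \<open>\<Gamma>(s) \<omega>(s)\<close> is the Mellin
  transform of \<open>(L s x)\<^sup>2\<close>. As \<open>x\<close> tends to \<open>0\<close> we have \<open>L s x = \<Gamma>(1 - s) x powr (s - 1) + R s x\<close>, where \<open>R\<close>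
  and all its \<open>x\<close>-derivatives, which are \<open>R (s - m) x\<close> up to sign, are bounded on \<open>(0, 1]\<close>; this follows
  from a representation of \<open>R (s - N)\<close> as a Weyl fractional integral of \<open>R (-N)\<close>, which is up to sign the
  \<open>N\<close>-th derivative of \<open>\<phi>(y) = 1 / (exp y - 1) - 1 / y\<close>. Expanding the square and integrating
  by parts repeatedly continues \<open>\<omega>\<close> to the plane, and at \<open>s = -n\<close> only boundary terms at \<open>x = 0\<close> survive:
  \<open>\<omega>(-n)\<close> is a quadratic expression in the derivatives of \<open>\<phi>\<close> at \<open>0\<close>, that is, in Bernoulli numbers.
  For odd \<open>n\<close> each of its terms contains an even-indexed derivative, which vanishes. For even \<open>n > 0\<close> one uses
  that \<open>F = 1 / (exp X - 1)\<close> satisfies \<open>F' = -F - F\<^sup>2\<close> and has a simple pole: the square of the \<open>n\<close>-th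
  derivative of \<open>F\<close> is therefore the combination of derivatives of \<open>F\<close> with the same polar part, and comparing
  coefficients of \<open>X ^ n\<close> gives \<open>3 \<omega>(-n) = 0\<close>.
\<close>

section \<open>Complex powers and Mellin transforms\<close>

text \<open>Expanding \<open>R\<close> in powers of \<open>x\<close> would bring in the zeta values
  at \<open>s - k\<close>. The Weyl integral avoids them: bounded derivatives are enough for
  integration by parts, and exact values enter only at \<open>s = -n\<close>, where \<open>R\<close>
  is elementary. As \<open>Gamma (1 - s)\<close> has a pole at \<open>1\<close>, the construction
  lives in \<open>Re s < 1\<close>; it meets the series in the strip \<open>2/3 < Re s < 1\<close>.

  The square of the power contributes the factor \<open>1 / (3 s - 2)\<close>. The cross term
  contributes the poles of \<open>Gamma (2 s - 1)\<close>; the zeros of \<open>1 / Gamma s\<close>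
  remove those at nonpositive integers but not those at half-integers, so holomorphy is proved for
  \<open>omega\<close> times two correcting factors.

  Let \<open>p k\<close> be the \<open>k\<close>-th derivative of \<open>\<phi>\<close> at
  \<open>0\<close>. At \<open>s = -n\<close> the cross term leaves a multiple \<open>U\<close> of
  \<open>p (3 n + 1)\<close>, and the square of \<open>R\<close> leaves, up to sign, a Leibniz sum
  \<open>V\<close> of the products \<open>p (n + i) * p (2 n - i)\<close>. For even \<open>n\<close>
  the coefficient comparison reads \<open>2 U + V = - U + 2 V'\<close> with \<open>V'\<close> the
  alternating version of \<open>V\<close>. As \<open>p k = 0\<close> for even \<open>k > 0\<close>,
  one has \<open>V' = - V\<close> when \<open>n > 0\<close>, whence the factor \<open>3\<close>. The
  exceptional value at \<open>n = 0\<close> is due to \<open>p 0 = - 1 / 2\<close>.\<close>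

text \<open>
  For \<open>x > 0\<close> this is \<open>of_real x powr s\<close>; written through the real logarithm it is measurable without
  side conditions (the value at \<open>0\<close> is the junk value \<open>1\<close>).
\<close>

definition rpow :: "real \<Rightarrow> complex \<Rightarrow> complex" where
  "rpow x s = exp (s * of_real (ln x))"

definition half_line :: "real measure" where
  "half_line = restrict_space lborel {0<..}"

lemma not_nonpos_Int_if_Re_pos: "Re s > 0 \<Longrightarrow> s \<notin> \<int>\<^sub>\<le>\<^sub>0"
  by (auto elim!: nonpos_Ints_cases)

lemma rpow_eq: "x > 0 \<Longrightarrow> rpow x s = of_real x powr s"
  by (simp add: rpow_def powr_def Ln_of_real)

lemma rpow_add: "rpow x (s + t) = rpow x s * rpow x t"
  by (simp add: rpow_def exp_add ring_distribs)

lemma rpow_0 [simp]: "rpow x 0 = 1" and rpow_base_1 [simp]: "rpow 1 s = 1"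
  by (simp_all add: rpow_def)

lemma rpow_mult: "x > 0 \<Longrightarrow> y > 0 \<Longrightarrow> rpow (x * y) s = rpow x s * rpow y s"
  by (simp add: rpow_def ln_mult exp_add ring_distribs)

lemma rpow_of_nat: "x > 0 \<Longrightarrow> rpow x (of_nat n) = of_real x ^ n"
  by (simp add: rpow_eq powr_nat')

lemma norm_rpow: "x > 0 \<Longrightarrow> norm (rpow x s) = x powr Re s"
  by (simp add: rpow_def powr_def)

lemma rpow_of_real: "x > 0 \<Longrightarrow> rpow x (of_real a) = of_real (x powr a)"
  by (simp add: rpow_def powr_def flip: exp_of_real)

lemma measurable_rpow [measurable]:
  "f \<in> borel_measurable M \<Longrightarrow> (\<lambda>x. rpow (f x) s) \<in> borel_measurable M"
  unfolding rpow_def by measurable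

lemma continuous_on_rpow [continuous_intros]:
  "continuous_on A f \<Longrightarrow> (\<And>x. x \<in> A \<Longrightarrow> f x > 0) \<Longrightarrow> continuous_on A (\<lambda>x. rpow (f x) s)"
  unfolding rpow_def by (intro continuous_intros) force+

lemma holomorphic_rpow [holomorphic_intros]:
  "f holomorphic_on A \<Longrightarrow> (\<lambda>s. rpow x (f s)) holomorphic_on A"
  unfolding rpow_def by (intro holomorphic_intros)

lemma has_vector_derivative_rpow:
  assumes "x > 0"
  shows "((\<lambda>x. rpow x s) has_vector_derivative s * rpow x (s - 1)) (at x within A)"
proof -
  have "((\<lambda>x. s * complex_of_real (ln x)) has_vector_derivative s * of_real (1 / x)) (at x within A)"
    using assms
    by (intro has_vector_derivative_mult_right has_vector_derivative_of_real)
       (auto intro!: derivative_eq_intros)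
  from field_vector_diff_chain_within[OF this, of exp "exp (s * of_real (ln x))"]
  have "((\<lambda>x. rpow x s) has_vector_derivative (s * of_real (1 / x)) * rpow x s) (at x within A)"
    unfolding rpow_def o_def by (simp add: DERIV_exp has_field_derivative_at_within)
  moreover have "rpow x (s - 1) = rpow x s * of_real (1 / x)"
    using assms by (simp add: rpow_def ring_distribs exp_diff exp_of_real flip: of_real_inverse)
  ultimately show ?thesis by (simp add: mult_ac)
qed

lemma space_half_line [simp]: "space half_line = {0<..}"
  by (simp add: half_line_def space_restrict_space)

lemma sigma_finite_half_line: "sigma_finite_measure half_line"
  unfolding half_line_def by (intro sigma_finite_measure_restrict_space lborel.sigma_finite_measure_axioms) auto

lemma integrable_half_line: "integrable half_line f \<longleftrightarrow> set_integrable lborel {0<..} f"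
  for f :: "real \<Rightarrow> 'b::{banach, second_countable_topology}"
  unfolding half_line_def set_integrable_def by (rule integrable_restrict_space) auto

lemma integral_half_line: "integral\<^sup>L half_line f = (LINT x:{0<..}|lborel. f x)"
  for f :: "real \<Rightarrow> 'b::{banach, second_countable_topology}"
  unfolding half_line_def set_lebesgue_integral_def by (rule integral_restrict_space) auto

lemma measurable_half_line: "f \<in> borel_measurable borel \<Longrightarrow> f \<in> borel_measurable half_line"
  by (simp add: half_line_def measurable_restrict_space1)

lemma half_line_Gamma_integral:
  assumes s: "Re s > 0" and a: "a > 0"
  shows "integrable half_line (\<lambda>x. rpow x (s - 1) * of_real (exp (- a * x)))"
    and "(\<integral>x. rpow x (s - 1) * of_real (exp (- a * x)) \<partial>half_line) = Gamma s * rpow a (- s)"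
proof -
  define f where "f = (\<lambda>x. indicator {0<..} x *\<^sub>R (rpow x (s - 1) * of_real (exp (- x))))"
  have f_eq: "indicator {0<..} x *\<^sub>R (complex_of_real x powr (s - 1) / of_real (exp x)) = f x" for x
    by (auto simp: f_def rpow_eq exp_minus field_simps indicator_def)
  have meas: "f \<in> borel_measurable borel"
    unfolding f_def by measurable
  have "integrable (completion lborel) f"
    using absolutely_integrable_Gamma_integral'[OF s] unfolding set_integrable_def f_eq .
  hence int: "integrable lborel f"
    using integrable_completion[of f lborel] meas by simp
  have "(LINT x:{0<..}|lborel. rpow x (s - 1) * of_real (exp (- x))) =
      integral {0<..} (\<lambda>x. rpow x (s - 1) * of_real (exp (- x)))"
    using int unfolding f_def by (intro set_borel_integral_eq_integral) (simp add: set_integrable_def)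
  also have "\<dots> = integral {0<..} (\<lambda>t. of_real t powr (s - 1) / of_real (exp t))"
    by (intro integral_cong) (auto simp: rpow_eq exp_minus field_simps)
  also have "\<dots> = Gamma s"
    using Gamma_integral_complex'[OF s] by (rule integral_unique)
  finally have val: "integral\<^sup>L lborel f = Gamma s"
    by (simp add: f_def set_lebesgue_integral_def)
  have scale: "indicator {0<..} x *\<^sub>R (rpow x (s - 1) * of_real (exp (- a * x))) =
      rpow a (1 - s) * f (0 + a * x)" for x
  proof (cases "x > 0")
    case True
    have "rpow a (s - 1) * rpow a (1 - s) = 1"
      by (simp flip: rpow_add)
    thus ?thesis using True a by (simp add: f_def rpow_mult mult_ac)
  qed (use a in \<open>auto simp: f_def zero_less_mult_iff\<close>)
  show "integrable half_line (\<lambda>x. rpow x (s - 1) * of_real (exp (- a * x)))"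
    unfolding integrable_half_line set_integrable_def scale
    using lborel_integrable_real_affine[OF int, of a 0] a by simp
  have "Gamma s = a *\<^sub>R (\<integral>x. f (0 + a * x) \<partial>lborel)"
    using lborel_integral_real_affine[of a f 0] a val by simp
  hence "rpow a (1 - s) * (\<integral>x. f (0 + a * x) \<partial>lborel) = Gamma s * (rpow a (1 - s) / of_real a)"
    using a by (simp add: scaleR_conv_of_real)
  also have "rpow a (1 - s) / of_real a = rpow a (- s)"
    using a rpow_add[of a "1" "- s"] rpow_of_nat[of a 1] by simp
  finally show "(\<integral>x. rpow x (s - 1) * of_real (exp (- a * x)) \<partial>half_line) = Gamma s * rpow a (- s)"
    unfolding integral_half_line set_lebesgue_integral_def scale by simp
qed

text \<open>Fubini combined with the Gamma integral of each single exponential. The measure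
  \<open>M\<close> is left general so that sums over \<open>k\<close>, integrals over
  \<open>t\<close> and the double sum over \<open>(j, k)\<close> are all instances.\<close>

lemma Mellin_exponential_integral:
  fixes l :: "'a \<Rightarrow> real" and a :: "'a \<Rightarrow> complex"
  assumes M: "sigma_finite_measure M"
    and [measurable]: "l \<in> borel_measurable M" "a \<in> borel_measurable M"
    and l: "\<And>p. p \<in> space M \<Longrightarrow> l p > 0" and s: "Re s > 0"
    and int: "integrable M (\<lambda>p. norm (a p) * l p powr (- Re s))"
  shows "integrable half_line (\<lambda>x. rpow x (s - 1) * (\<integral>p. a p * of_real (exp (- l p * x)) \<partial>M))"
    and "(\<integral>x. rpow x (s - 1) * (\<integral>p. a p * of_real (exp (- l p * x)) \<partial>M) \<partial>half_line) =
      Gamma s * (\<integral>p. a p * rpow (l p) (- s) \<partial>M)"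
proof -
  interpret sigma_finite_measure M by fact
  interpret H: sigma_finite_measure half_line by (rule sigma_finite_half_line)
  interpret pair_sigma_finite M half_line ..
  define f where "f p x = a p * (rpow x (s - 1) * of_real (exp (- l p * x)))" for p x
  \<comment> \<open>The Gamma integral at the real exponent \<open>Re s\<close>, read off as a real
    part; it supplies the iterated integral of norms for Fubini.\<close>
  have nrm: "(\<integral>x. norm (f p x) \<partial>half_line) = Gamma (Re s) * (norm (a p) * l p powr (- Re s))"
    if p: "p \<in> space M" for p
  proof -
    have "(\<integral>x. norm (f p x) \<partial>half_line) =
        (\<integral>x. norm (a p) * Re (rpow x (of_real (Re s) - 1) * of_real (exp (- l p * x))) \<partial>half_line)"
    proof (intro Bochner_Integration.integral_cong refl)
      fix x assume "x \<in> space half_line"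
      hence x: "x > 0" by simp
      have "norm (f p x) = norm (a p) * (x powr (Re s - 1) * exp (- l p * x))"
        using x by (simp add: f_def norm_mult norm_rpow)
      also have "x powr (Re s - 1) * exp (- l p * x) =
          Re (rpow x (of_real (Re s - 1)) * of_real (exp (- l p * x)))"
        unfolding rpow_of_real[OF x] by simp
      finally show "norm (f p x) =
          norm (a p) * Re (rpow x (of_real (Re s) - 1) * of_real (exp (- l p * x)))" by simp
    qed
    also have "\<dots> = norm (a p) * (\<integral>x. Re (rpow x (of_real (Re s) - 1) * of_real (exp (- l p * x))) \<partial>half_line)"
      by simp
    also have "\<dots> = norm (a p) * Re (\<integral>x. rpow x (of_real (Re s) - 1) * of_real (exp (- l p * x)) \<partial>half_line)"
      using half_line_Gamma_integral(1)[of "of_real (Re s)" "l p"] s l[OF p]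
      by (subst integral_Re) (auto simp del: of_real_exp)
    also have "\<dots> = norm (a p) * Re (Gamma (of_real (Re s)) * rpow (l p) (- of_real (Re s)))"
      using s l[OF p] by (subst half_line_Gamma_integral) auto
    also have "rpow (l p) (- of_real (Re s)) = of_real (l p powr (- Re s))"
      using rpow_of_real[OF l[OF p], of "- Re s"] by simp
    finally show ?thesis by (simp add: Gamma_complex_of_real)
  qed
  have intf: "integrable (M \<Otimes>\<^sub>M half_line) (case_prod f)"
  proof (rule Fubini_integrable)
    have [measurable]: "snd \<in> borel_measurable (M \<Otimes>\<^sub>M half_line)"
      using measurable_compose[OF measurable_snd measurable_half_line[of "\<lambda>x. x"]] by simp
    show "case_prod f \<in> borel_measurable (M \<Otimes>\<^sub>M half_line)"
      unfolding f_def by measurable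
    have "integrable M (\<lambda>p. Gamma (Re s) * (norm (a p) * l p powr (- Re s)))"
      using int by simp
    thus "integrable M (\<lambda>p. \<integral>x. norm (case_prod f (p, x)) \<partial>half_line)"
      by (subst Bochner_Integration.integrable_cong[OF refl, of _ _ "\<lambda>p. Gamma (Re s) * (norm (a p) * l p powr (- Re s))"])
         (simp_all add: nrm)
    show "AE p in M. integrable half_line (\<lambda>x. case_prod f (p, x))"
      unfolding f_def prod.case using s l
      by (intro AE_I2 integrable_mult_right half_line_Gamma_integral) auto
  qed
  have inner: "(\<integral>p. f p x \<partial>M) = rpow x (s - 1) * (\<integral>p. a p * of_real (exp (- l p * x)) \<partial>M)" for x
    unfolding f_def by (subst integral_mult_right_zero[symmetric]) (simp add: mult_ac)
  show "integrable half_line (\<lambda>x. rpow x (s - 1) * (\<integral>p. a p * of_real (exp (- l p * x)) \<partial>M))"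
    using integrable_snd[OF intf] unfolding inner .
  have "(\<integral>x. (\<integral>p. f p x \<partial>M) \<partial>half_line) = (\<integral>p. (\<integral>x. f p x \<partial>half_line) \<partial>M)"
    using integral_fst[OF intf] integral_snd[OF intf] by simp
  also have "\<dots> = (\<integral>p. Gamma s * (a p * rpow (l p) (- s)) \<partial>M)"
  proof (intro Bochner_Integration.integral_cong refl)
    fix p assume "p \<in> space M"
    thus "(\<integral>x. f p x \<partial>half_line) = Gamma s * (a p * rpow (l p) (- s))"
      using half_line_Gamma_integral(2)[OF s l[of p]] unfolding f_def by simp
  qed
  also have "\<dots> = Gamma s * (\<integral>p. a p * rpow (l p) (- s) \<partial>M)" by simp
  finally show "(\<integral>x. rpow x (s - 1) * (\<integral>p. a p * of_real (exp (- l p * x)) \<partial>M) \<partial>half_line) =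
      Gamma s * (\<integral>p. a p * rpow (l p) (- s) \<partial>M)" unfolding inner .
qed

section \<open>Holomorphic dependence of integrals on a parameter\<close>

text \<open>A majorant \<open>g\<close> of the integrand also controls its derivative: discs of
  radius \<open>r / 4\<close> about points of \<open>ball s (r / 2)\<close> stay inside
  \<open>cball s r\<close>, so Cauchy's inequality bounds the derivative there by
  \<open>4 / r * g\<close>. The difference quotients obey the same bound, and dominated convergence
  along sequences applies.\<close>

lemma has_field_derivative_lebesgue_integral:
  fixes f :: "complex \<Rightarrow> 'a \<Rightarrow> complex"
  assumes S: "open S" and s: "s \<in> S"
    and hol: "\<And>x. x \<in> space M \<Longrightarrow> (\<lambda>s. f s x) holomorphic_on S"
    and meas: "\<And>s. s \<in> S \<Longrightarrow> f s \<in> borel_measurable M"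
    and r0: "r0 > 0" and g: "integrable M g"
    and gb: "\<And>z x. z \<in> S \<Longrightarrow> dist z s < r0 \<Longrightarrow> x \<in> space M \<Longrightarrow> norm (f z x) \<le> g x"
  shows "((\<lambda>s. \<integral>x. f s x \<partial>M) has_field_derivative (\<integral>x. deriv (\<lambda>s. f s x) s \<partial>M)) (at s)"
proof -
  obtain r1 where r1: "r1 > 0" "cball s r1 \<subseteq> S"
    using S s open_contains_cball_eq by blast
  define r where "r = min r1 (r0 / 2)"
  have r: "r > 0" "cball s r \<subseteq> S" "r < r0"
    using r0 r1 by (auto simp: r_def min_def)
  have gr: "norm (f z x) \<le> g x" if "z \<in> cball s r" "x \<in> space M" for z x
    using that r gb[of z x] by (auto simp: dist_commute)
  have quot: "norm ((f z x - f s x) / (z - s)) \<le> 4 / r * g x"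
    if z: "z \<in> ball s (r / 2)" and x: "x \<in> space M" for z x
  proof -
    have holx: "(\<lambda>s. f s x) holomorphic_on cball s r"
      using hol[OF x] r(2) holomorphic_on_subset by blast
    have "norm (f z x - f s x) \<le> (4 / r * g x) * norm (z - s)"
    proof (rule field_differentiable_bound[of "ball s (r / 2)" "\<lambda>s. f s x" "deriv (\<lambda>s. f s x)"])
      fix w assume w: "w \<in> ball s (r / 2)"
      have "(\<lambda>s. f s x) holomorphic_on ball s r"
        using holx by (rule holomorphic_on_subset) auto
      thus "((\<lambda>s. f s x) has_field_derivative deriv (\<lambda>s. f s x) w) (at w within ball s (r / 2))"
        using w r(1) by (intro holomorphic_derivI[THEN has_field_derivative_at_within, of _ "ball s r"]) auto
      have sub: "cball w (r / 4) \<subseteq> cball s r"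
      proof
        fix y assume "y \<in> cball w (r / 4)"
        with w have "dist s y \<le> r / 2 + r / 4"
          by (intro order.trans[OF dist_triangle[of s y w]] add_mono) auto
        with r(1) show "y \<in> cball s r" by simp
      qed
      have "norm ((deriv ^^ 1) (\<lambda>s. f s x) w) \<le> fact 1 * g x / (r / 4) ^ 1"
      proof (rule Cauchy_inequality)
        show "(\<lambda>s. f s x) holomorphic_on ball w (r / 4)"
          using holx by (rule holomorphic_on_subset) (use sub in \<open>auto simp: subset_iff\<close>)
        show "continuous_on (cball w (r / 4)) (\<lambda>s. f s x)"
          using holx sub by (meson continuous_on_subset holomorphic_on_imp_continuous_on)
        fix y assume "norm (w - y) = r / 4"
        hence "y \<in> cball w (r / 4)" by (simp add: dist_norm)
        thus "norm (f y x) \<le> g x" using sub gr x by blast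
      qed (use r in auto)
      thus "norm (deriv (\<lambda>s. f s x) w) \<le> 4 / r * g x" by (simp add: field_simps)
    qed (use z r in auto)
    moreover have "0 \<le> 4 / r * g x"
      using gr[of s x] x r(1) order.trans[OF norm_ge_zero] by (intro mult_nonneg_nonneg) auto
    ultimately show ?thesis by (cases "z = s") (auto simp: norm_divide divide_simps)
  qed
  have lim: "((\<lambda>z. (f z x - f s x) / (z - s)) \<longlongrightarrow> deriv (\<lambda>s. f s x) s) (at s)" if "x \<in> space M" for x
    using holomorphic_derivI[OF hol[OF that] S s] by (simp add: has_field_derivative_iff)
  have intf: "integrable M (f z)" if "z \<in> cball s r" for z
    using that r(2) by (intro Bochner_Integration.integrable_bound[OF g meas] AE_I2)
      (use gr in \<open>force+\<close>)
  have "((\<lambda>z. ((\<integral>x. f z x \<partial>M) - (\<integral>x. f s x \<partial>M)) / (z - s)) \<longlongrightarrow> (\<integral>x. deriv (\<lambda>s. f s x) s \<partial>M)) (at s)"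
    unfolding tendsto_at_iff_sequentially
  proof (intro allI impI)
    fix X :: "nat \<Rightarrow> complex"
    assume X: "\<forall>i. X i \<in> UNIV - {s}" "X \<longlonglongrightarrow> s"
    have "eventually (\<lambda>n. X n \<in> ball s (r / 2)) sequentially"
      using X(2) r(1) by (intro topological_tendstoD) auto
    then obtain N where N: "\<And>n. n \<ge> N \<Longrightarrow> X n \<in> ball s (r / 2)"
      by (auto simp: eventually_sequentially)
    define Y where "Y n = X (n + N)" for n
    have Yb: "Y n \<in> ball s (r / 2)" for n using N by (simp add: Y_def)
    have Yc: "Y n \<in> cball s r" for n using Yb[of n] r(1) by simp
    have Yl: "Y \<longlonglongrightarrow> s" unfolding Y_def by (rule LIMSEQ_ignore_initial_segment[OF X(2)])
    have Yl': "filterlim Y (at s) sequentially"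
      unfolding filterlim_at using Yl X(1) by (auto simp: Y_def)
    have sc: "s \<in> cball s r" using r by simp
    have limx: "(\<lambda>n. (f (Y n) x - f s x) / (Y n - s)) \<longlonglongrightarrow> deriv (\<lambda>s. f s x) s" if "x \<in> space M" for x
      using filterlim_compose[OF lim[OF that] Yl'] .
    have m: "(\<lambda>x. (f (Y n) x - f s x) / (Y n - s)) \<in> borel_measurable M" for n
      using intf[OF Yc] intf[OF sc] by (intro borel_measurable_divide borel_measurable_diff) auto
    have "(\<lambda>n. \<integral>x. (f (Y n) x - f s x) / (Y n - s) \<partial>M) \<longlonglongrightarrow> (\<integral>x. deriv (\<lambda>s. f s x) s \<partial>M)"
    proof (rule integral_dominated_convergence[where w = "\<lambda>x. 4 / r * g x"])
      show "(\<lambda>x. deriv (\<lambda>s. f s x) s) \<in> borel_measurable M"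
        using m limx by (rule borel_measurable_LIMSEQ_metric)
    qed (use m limx quot Yb g in auto)
    hence "(\<lambda>n. ((\<integral>x. f (Y n) x \<partial>M) - (\<integral>x. f s x \<partial>M)) / (Y n - s)) \<longlonglongrightarrow> (\<integral>x. deriv (\<lambda>s. f s x) s \<partial>M)"
      by (simp add: Bochner_Integration.integral_diff[OF intf[OF Yc] intf[OF sc]])
    thus "((\<lambda>z. ((\<integral>x. f z x \<partial>M) - (\<integral>x. f s x \<partial>M)) / (z - s)) \<circ> X) \<longlonglongrightarrow> (\<integral>x. deriv (\<lambda>s. f s x) s \<partial>M)"
      unfolding Y_def o_def by (rule LIMSEQ_offset)
  qed
  thus ?thesis
    unfolding has_field_derivative_iff .
qed

lemma holomorphic_on_lebesgue_integral:
  fixes f :: "complex \<Rightarrow> 'a \<Rightarrow> complex"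
  assumes S: "open S"
    and hol: "\<And>x. x \<in> space M \<Longrightarrow> (\<lambda>s. f s x) holomorphic_on S"
    and meas: "\<And>s. s \<in> S \<Longrightarrow> f s \<in> borel_measurable M"
    and dom: "\<And>s. s \<in> S \<Longrightarrow> \<exists>r>0. \<exists>g. integrable M g \<and>
      (\<forall>z\<in>S. dist z s < r \<longrightarrow> (\<forall>x\<in>space M. norm (f z x) \<le> g x))"
  shows "(\<lambda>s. \<integral>x. f s x \<partial>M) holomorphic_on S"
  unfolding holomorphic_on_open[OF S]
proof
  fix s assume s: "s \<in> S"
  then obtain r g where "r > 0" "integrable M g"
    "\<forall>z\<in>S. dist z s < r \<longrightarrow> (\<forall>x\<in>space M. norm (f z x) \<le> g x)"
    using dom[OF s] by blast
  thus "\<exists>f'. ((\<lambda>s. \<integral>x. f s x \<partial>M) has_field_derivative f') (at s)"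
    using has_field_derivative_lebesgue_integral[OF S s hol meas, of r g] by blast
qed

section \<open>Exponential polylogarithms\<close>

text \<open>The polylogarithm of order \<open>s\<close> at \<open>exp (- z)\<close>. It is written
  as an integral over a counting measure so that the Mellin and holomorphy results for integrals
  apply to it directly.\<close>

definition polylog_exp :: "complex \<Rightarrow> complex \<Rightarrow> complex" where
  "polylog_exp s z = (\<integral>k. rpow (real k) (- s) * exp (- of_nat k * z) \<partial>count_space {1..})"

lemma integrable_count_space_atLeast_1:
  fixes f :: "nat \<Rightarrow> 'b::{banach, second_countable_topology}"
  assumes "summable (\<lambda>k. norm (f k))"
  shows "integrable (count_space {1..}) f"
proof -
  have "Infinite_Set_Sum.abs_summable_on f UNIV"
    using assms by (simp add: abs_summable_on_nat_iff')
  hence "Infinite_Set_Sum.abs_summable_on f {1..}" by (rule abs_summable_on_subset) auto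
  thus ?thesis by (simp add: abs_summable_on_def)
qed

lemma integrable_powr_exp:
  assumes "x > 0"
  shows "integrable (count_space {1..}) (\<lambda>k. real k powr a * exp (- (real k * x)))"
proof (rule integrable_count_space_atLeast_1)
  have "(\<lambda>k. real k powr a * exp (- (real k * x))) \<in> O(\<lambda>k. 1 / real k ^ 2)"
    using assms by real_asymp
  hence "(\<lambda>k. norm (real k powr a * exp (- (real k * x)))) \<in> O(\<lambda>k. 1 / real k ^ 2)"
    by simp
  thus "summable (\<lambda>k. norm (real k powr a * exp (- (real k * x))))"
    by (rule summable_comparison_test_bigo[rotated]) (use inverse_power_summable[of 2, where 'a = real] in \<open>simp add: inverse_eq_divide\<close>)
qed

lemma norm_polylog_term:
  "k \<ge> 1 \<Longrightarrow> norm (rpow (real k) (- s) * exp (- of_nat k * z)) = real k powr (- Re s) * exp (- (real k * Re z))"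
  by (simp add: norm_mult norm_rpow)

lemma polylog_term_le:
  assumes "k \<ge> 1" "Re s \<ge> - a" "Re z \<ge> x"
  shows "norm (rpow (real k) (- s) * exp (- of_nat k * z)) \<le> real k powr a * exp (- (real k * x))"
  unfolding norm_polylog_term[OF assms(1)]
  using assms by (intro mult_mono powr_mono) (auto simp: mult_left_mono)

lemma integrable_polylog_term:
  assumes "Re z > 0"
  shows "integrable (count_space {1..}) (\<lambda>k. rpow (real k) (- s) * exp (- of_nat k * z))"
proof (rule Bochner_Integration.integrable_bound[OF integrable_powr_exp[OF assms, of "- Re s"]])
  show "AE k in count_space {1..}. norm (rpow (real k) (- s) * exp (- of_nat k * z)) \<le>
      norm (real k powr (- Re s) * exp (- (real k * Re z)))"
    using polylog_term_le[of _ "- Re s" s "Re z" z] by (intro AE_I2) auto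
qed auto

text \<open>From \<open>(k - 1) (x - 1) \<ge> 0\<close> and \<open>k + x \<ge> 2\<close> one gets
  \<open>k x \<ge> k / 2 + x / 2\<close>. So a factor \<open>exp (- (x / 2))\<close> splits off
  uniformly in \<open>k\<close>, and the remaining series depends only on \<open>a\<close>.\<close>

lemma norm_polylog_exp_le:
  assumes "x \<ge> 1" "Re s \<ge> - a"
  shows "norm (polylog_exp s (of_real x)) \<le>
    (\<integral>k. real k powr a * exp (- (real k * (1 / 2))) \<partial>count_space {1..}) * exp (- (x / 2))"
proof -
  have "norm (polylog_exp s (of_real x)) \<le>
      (\<integral>k. norm (rpow (real k) (- s) * exp (- of_nat k * of_real x)) \<partial>count_space {1..})"
    unfolding polylog_exp_def by (rule integral_norm_bound)
  also have "\<dots> \<le> (\<integral>k. real k powr a * exp (- (real k * (1 / 2))) * exp (- (x / 2)) \<partial>count_space {1..})"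
  proof (intro integral_mono integrable_norm integrable_polylog_term integrable_mult_left integrable_powr_exp)
    fix k :: nat assume "k \<in> space (count_space {1..})"
    hence k: "k \<ge> 1" by simp
    have "0 \<le> (real k - 1) * (x - 1)"
      using k assms(1) by (intro mult_nonneg_nonneg) auto
    hence "real k + x - 1 \<le> real k * x" by (simp add: algebra_simps)
    hence "real k * (1 / 2) + x / 2 \<le> real k * x"
      using k assms(1) by simp
    hence le: "exp (- (real k * x)) \<le> exp (- (real k * (1 / 2))) * exp (- (x / 2))"
      by (simp flip: exp_add)
    have "norm (rpow (real k) (- s) * exp (- of_nat k * of_real x)) \<le> real k powr a * exp (- (real k * x))"
      using k assms by (intro polylog_term_le) auto
    also have "\<dots> \<le> real k powr a * (exp (- (real k * (1 / 2))) * exp (- (x / 2)))"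
      by (intro mult_left_mono) (use le in auto)
    finally show "norm (rpow (real k) (- s) * exp (- of_nat k * of_real x)) \<le>
        real k powr a * exp (- (real k * (1 / 2))) * exp (- (x / 2))"
      by (simp only: mult.assoc)
  qed (use assms in auto)
  finally show ?thesis by simp
qed

lemma holomorphic_polylog_exp:
  assumes "Re z > 0"
  shows "(\<lambda>s. polylog_exp s z) holomorphic_on UNIV"
  unfolding polylog_exp_def
proof (rule holomorphic_on_lebesgue_integral)
  fix s :: complex
  show "\<exists>r>0. \<exists>g. integrable (count_space {1..}) g \<and> (\<forall>t\<in>UNIV. dist t s < r \<longrightarrow>
      (\<forall>k\<in>space (count_space {1..}). norm (rpow (real k) (- t) * exp (- of_nat k * z)) \<le> g k))"
  proof (intro exI[of _ 1] conjI exI ballI impI)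
    show "integrable (count_space {1..}) (\<lambda>k. real k powr (1 - Re s) * exp (- (real k * Re z)))"
      by (rule integrable_powr_exp[OF assms])
    fix t :: complex and k :: nat assume t: "dist t s < 1" and k: "k \<in> space (count_space {1..})"
    have "Re t \<ge> Re s - 1"
      using t abs_Re_le_cmod[of "t - s"] by (simp add: dist_norm)
    thus "norm (rpow (real k) (- t) * exp (- of_nat k * z)) \<le> real k powr (1 - Re s) * exp (- (real k * Re z))"
      using k by (intro polylog_term_le) auto
  qed auto
qed (auto intro!: holomorphic_intros)

text \<open>Each term acquires a factor \<open>- k\<close> under differentiation, and this factor is
  absorbed by lowering \<open>s\<close> by one. Hence all derivatives stay within the same family of
  functions.\<close>

lemma has_field_derivative_polylog_exp:
  assumes "Re z > 0"
  shows "(polylog_exp s has_field_derivative - polylog_exp (s - 1) z) (at z)"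
proof -
  define S where "S = {w. Re w > Re z / 2}"
  have drv: "deriv (\<lambda>z. rpow (real k) (- s) * exp (- of_nat k * z)) z =
      - (rpow (real k) (- (s - 1)) * exp (- of_nat k * z))" if "k \<ge> 1" for k
  proof -
    have "((\<lambda>z. rpow (real k) (- s) * exp (- of_nat k * z)) has_field_derivative
        rpow (real k) (- s) * (exp (- of_nat k * z) * - of_nat k)) (at z)"
      by (auto intro!: derivative_eq_intros)
    moreover have "rpow (real k) (- (s - 1)) = rpow (real k) (- s) * of_nat k"
      using that rpow_add[of "real k" "- s" 1] rpow_of_nat[of "real k" 1] by simp
    ultimately show ?thesis by (simp add: DERIV_imp_deriv mult_ac)
  qed
  have "((\<lambda>z. \<integral>k. rpow (real k) (- s) * exp (- of_nat k * z) \<partial>count_space {1..}) has_field_derivative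
      (\<integral>k. deriv (\<lambda>z. rpow (real k) (- s) * exp (- of_nat k * z)) z \<partial>count_space {1..})) (at z)"
  proof (rule has_field_derivative_lebesgue_integral[where S = S and ?r0.0 = 1
        and g = "\<lambda>k. real k powr (- Re s) * exp (- (real k * (Re z / 2)))"])
    show "open S" unfolding S_def by (rule open_halfspace_Re_gt)
    show "integrable (count_space {1..}) (\<lambda>k. real k powr (- Re s) * exp (- (real k * (Re z / 2))))"
      using assms by (intro integrable_powr_exp) simp
    fix w :: complex and k :: nat assume "w \<in> S" "k \<in> space (count_space {1..})"
    thus "norm (rpow (real k) (- s) * exp (- of_nat k * w)) \<le> real k powr (- Re s) * exp (- (real k * (Re z / 2)))"
      by (intro polylog_term_le) (auto simp: S_def)
  qed (use assms in \<open>auto intro!: holomorphic_intros simp: S_def\<close>)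
  also have "(\<integral>k. deriv (\<lambda>z. rpow (real k) (- s) * exp (- of_nat k * z)) z \<partial>count_space {1..}) =
      (\<integral>k. - (rpow (real k) (- (s - 1)) * exp (- of_nat k * z)) \<partial>count_space {1..})"
    by (intro Bochner_Integration.integral_cong refl drv) auto
  also have "\<dots> = - polylog_exp (s - 1) z"
    by (simp add: polylog_exp_def)
  finally show ?thesis unfolding polylog_exp_def[abs_def] .
qed

lemma polylog_exp_0:
  assumes "Re z > 0"
  shows "polylog_exp 0 z = 1 / (exp z - 1)"
proof -
  define q where "q = exp (- z)"
  have q: "norm q < 1" using assms by (simp add: q_def)
  have pow: "exp (- of_nat k * z) = q ^ k" for k
    unfolding q_def by (simp flip: exp_of_nat_mult)
  have abs: "Infinite_Set_Sum.abs_summable_on (\<lambda>k. q ^ k) A" for A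
  proof -
    have "Infinite_Set_Sum.abs_summable_on (\<lambda>k. q ^ k) UNIV"
      using q by (simp add: abs_summable_on_nat_iff' norm_power summable_geometric)
    thus ?thesis by (rule abs_summable_on_subset) auto
  qed
  have "polylog_exp 0 z = infsetsum (\<lambda>k. q ^ k) {1..}"
    unfolding infsetsum_def polylog_exp_def
    by (intro Bochner_Integration.integral_cong refl) (simp flip: pow)
  also have "\<dots> = (\<Sum>k. if k \<in> {1..} then q ^ k else 0)"
    by (rule infsetsum_nat[OF abs])
  also have "(\<lambda>k. if k \<in> {1..} then q ^ k else 0) sums (1 / (1 - q) - 1)"
    using geometric_sums[OF q] sums_If_finite_set'[of "\<lambda>k. q ^ k" "1 / (1 - q)" "{0}" "1 / (1 - q) - 1" "\<lambda>_. 0"]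
    by (auto simp: if_distrib Suc_le_eq cong: if_cong) (smt (verit) One_nat_def Suc_leI atLeast_iff gr0I not_one_le_zero sums_cong)
  hence "(\<Sum>k. if k \<in> {1..} then q ^ k else 0) = 1 / (1 - q) - 1"
    by (rule sums_unique[symmetric])
  also have "\<dots> = 1 / (exp z - 1)"
  proof -
    have "exp z \<noteq> 1" using assms by (metis less_irrefl norm_exp_eq_Re norm_one one_less_exp_iff)
    thus ?thesis by (simp add: q_def exp_minus field_simps)
  qed
  finally show ?thesis .
qed

section \<open>The function \<open>1 / (exp z - 1) - 1 / z\<close> and its extension to the
  origin\<close>

text \<open>
  \<open>(exp X - 1) / X\<close> and \<open>(exp X - 1 - X) / X\<^sup>2\<close>; their quotient removes the singularity of
  \<open>1 / (exp z - 1) - 1 / z\<close> at \<open>0\<close>.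
\<close>

definition exp_fps1 :: "complex fps" where "exp_fps1 = fps_shift 1 (fps_exp 1 - 1)"

definition exp_fps2 :: "complex fps" where "exp_fps2 = fps_shift 2 (fps_exp 1 - 1 - fps_X)"

definition bernoulli_fun :: "complex \<Rightarrow> complex" where
  "bernoulli_fun z = - eval_fps exp_fps2 z / eval_fps exp_fps1 z"

text \<open>The disc makes the domain an open set containing the origin, so that derivatives are
  continuous up to \<open>x = 0\<close>; its radius is below \<open>2 pi\<close>, which keeps the
  nonzero zeros of \<open>exp z - 1\<close> out.\<close>

definition bernoulli_dom :: "complex set" where
  "bernoulli_dom = {z. Re z > 0} \<union> ball 0 2"

lemma fps_conv_radius_exp_fps [simp]: "fps_conv_radius exp_fps1 = \<infinity>" "fps_conv_radius exp_fps2 = \<infinity>"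
proof -
  have 1: "fps_conv_radius (fps_exp 1 - 1 :: complex fps) = \<infinity>"
    using fps_conv_radius_diff[of "fps_exp 1 :: complex fps" 1] by simp
  have "fps_conv_radius (fps_exp 1 - 1 - fps_X :: complex fps) = \<infinity>"
    using fps_conv_radius_diff[of "fps_exp 1 - 1 :: complex fps" fps_X] 1 by simp
  with 1 show "fps_conv_radius exp_fps1 = \<infinity>" "fps_conv_radius exp_fps2 = \<infinity>"
    by (simp_all add: exp_fps1_def exp_fps2_def)
qed

lemma exp_fps1_nth_0 [simp]: "fps_nth exp_fps1 0 = 1"
  by (simp add: exp_fps1_def)

lemma exp_fps1_mult_X: "fps_X * exp_fps1 = fps_exp 1 - 1"
  by (rule fps_ext) (auto simp: exp_fps1_def)

lemma exp_fps2_mult_X: "fps_X * exp_fps2 = exp_fps1 - 1"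
  by (rule fps_ext) (auto simp: exp_fps1_def exp_fps2_def numeral_2_eq_2)

lemma eval_exp_fps1: "z * eval_fps exp_fps1 z = exp z - 1"
proof -
  have "eval_fps (fps_X * exp_fps1) z = eval_fps (fps_exp 1 - 1) z"
    by (simp only: exp_fps1_mult_X)
  thus ?thesis by (simp add: eval_fps_mult eval_fps_diff)
qed

lemma eval_exp_fps2: "z * eval_fps exp_fps2 z = eval_fps exp_fps1 z - 1"
proof -
  have "eval_fps (fps_X * exp_fps2) z = eval_fps (exp_fps1 - 1) z"
    by (simp only: exp_fps2_mult_X)
  thus ?thesis by (simp add: eval_fps_mult eval_fps_diff)
qed

lemma exp_neq_1_on_bernoulli_dom:
  assumes "z \<in> bernoulli_dom" "z \<noteq> 0"
  shows "exp z \<noteq> 1"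
proof
  assume "exp z = 1"
  then obtain n :: int where n: "Re z = 0" "Im z = of_int (2 * n) * pi"
    by (auto simp: exp_eq_1)
  with assms have "norm z < 2" by (auto simp: bernoulli_dom_def)
  moreover have "norm z = \<bar>Im z\<bar>" using n by (simp add: cmod_def)
  moreover have "n \<noteq> 0" using n assms(2) complex_eqI[of z 0] by auto
  hence "\<bar>Im z\<bar> \<ge> 2 * pi" unfolding n by (simp add: abs_mult)
  ultimately show False using pi_gt3 by linarith
qed

lemma eval_exp_fps1_neq_0:
  assumes "z \<in> bernoulli_dom"
  shows "eval_fps exp_fps1 z \<noteq> 0"
proof (cases "z = 0")
  case False
  thus ?thesis using eval_exp_fps1[of z] exp_neq_1_on_bernoulli_dom[OF assms] by auto
qed (simp add: eval_fps_at_0)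

lemma open_bernoulli_dom: "open bernoulli_dom"
  unfolding bernoulli_dom_def by (intro open_Un open_halfspace_Re_gt open_ball)

lemma holomorphic_bernoulli_fun: "bernoulli_fun holomorphic_on bernoulli_dom"
  unfolding bernoulli_fun_def[abs_def]
  by (intro holomorphic_intros) (auto simp: eval_exp_fps1_neq_0)

lemma bernoulli_fun_eq:
  assumes "z \<in> bernoulli_dom" "z \<noteq> 0"
  shows "bernoulli_fun z = 1 / (exp z - 1) - 1 / z"
proof -
  have a: "exp z - 1 \<noteq> 0" using exp_neq_1_on_bernoulli_dom[OF assms] by simp
  have 1: "eval_fps exp_fps1 z = (exp z - 1) / z"
    using eval_exp_fps1[of z] assms(2) by (simp add: eq_divide_eq mult.commute)
  have 2: "eval_fps exp_fps2 z = ((exp z - 1) / z - 1) / z"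
    using eval_exp_fps2[of z] assms(2) by (simp add: 1 eq_divide_eq mult.commute)
  have "- ((w / z - 1) / z) / (w / z) = 1 / w - 1 / z" if "w \<noteq> 0" for w
    using that assms(2) by (simp add: field_simps)
  from this[OF a] show ?thesis unfolding bernoulli_fun_def 1 2 .
qed

lemma bernoulli_fun_has_fps_expansion: "bernoulli_fun has_fps_expansion (- exp_fps2 / exp_fps1)"
  unfolding bernoulli_fun_def[abs_def]
  by (intro has_fps_expansion_divide' has_fps_expansion_minus eval_fps_has_fps_expansion) auto

text \<open>Both sides of case \<open>n + 1\<close> come from differentiating case \<open>n\<close>:
  the polylogarithm passes from order \<open>- n\<close> to order \<open>- n - 1\<close> with a
  minus sign, and the pole term behaves in the same way.\<close>

lemma polylog_exp_neg_nat:
  assumes "Re z > 0"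
  shows "polylog_exp (- of_nat n) z - fact n / z ^ Suc n = (- 1) ^ n * (deriv ^^ n) bernoulli_fun z"
  using assms
proof (induction n arbitrary: z)
  case 0
  hence "z \<in> bernoulli_dom" "z \<noteq> 0" by (auto simp: bernoulli_dom_def)
  thus ?case using 0 by (simp add: polylog_exp_0 bernoulli_fun_eq)
next
  case (Suc n)
  have z: "z \<in> bernoulli_dom" "z \<noteq> 0" using Suc.prems by (auto simp: bernoulli_dom_def)
  have "((deriv ^^ n) bernoulli_fun has_field_derivative (deriv ^^ Suc n) bernoulli_fun z) (at z)"
    using holomorphic_higher_deriv[OF holomorphic_bernoulli_fun open_bernoulli_dom, of n] z(1)
    by (auto intro: holomorphic_derivI[OF _ open_bernoulli_dom])
  from DERIV_cmult[OF this, of "(- 1) ^ n"]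
  have "((\<lambda>z. polylog_exp (- of_nat n) z - fact n / z ^ Suc n) has_field_derivative
      (- 1) ^ n * (deriv ^^ Suc n) bernoulli_fun z) (at z)"
    by (rule DERIV_cong_ev[THEN iffD1, rotated -1, OF _ refl _ refl])
       (use eventually_nhds_in_open[OF open_halfspace_Re_gt, of z 0] Suc in \<open>auto elim!: eventually_mono\<close>)
  moreover have "((\<lambda>z. polylog_exp (- of_nat n) z - fact n / z ^ Suc n) has_field_derivative
      - polylog_exp (- of_nat n - 1) z - - (fact n * of_nat (Suc n) * z ^ n) / (z ^ Suc n * z ^ Suc n)) (at z)"
    using z Suc.prems
    by (auto intro!: derivative_eq_intros has_field_derivative_polylog_exp simp del: power_Suc)
  ultimately have 1: "(- 1) ^ n * (deriv ^^ Suc n) bernoulli_fun z =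
      - polylog_exp (- of_nat n - 1) z - - (fact n * of_nat (Suc n) * z ^ n) / (z ^ Suc n * z ^ Suc n)"
    by (rule DERIV_unique)
  have 2: "fact n * of_nat (Suc n) * z ^ n / (z ^ Suc n * z ^ Suc n) = fact (Suc n) / z ^ Suc (Suc n)"
    using z by (simp add: field_simps)
  have 3: "- of_nat (Suc n) = - of_nat n - (1 :: complex)" by simp
  have "p - b = (- 1) ^ Suc n * d" if "(- 1) ^ n * d = - p - - x / y" "x / y = b" for p b d x y :: complex
    using that by (simp add: algebra_simps)
  from this[OF 1 2] show ?case unfolding 3 .
qed

section \<open>The part of the polylogarithm that stays bounded at the origin\<close>

text \<open>This is \<open>R s x\<close> of the overview: the leading singular power at
  \<open>x = 0\<close> is removed. The coefficient \<open>Gamma (1 - s)\<close> is the reason for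
  the later restriction to \<open>Re s < 1\<close>.\<close>

definition polylog_reg :: "complex \<Rightarrow> real \<Rightarrow> complex" where
  "polylog_reg s x = polylog_exp s (of_real x) - Gamma (1 - s) * rpow x (s - 1)"

lemma polylog_reg_neg_nat:
  assumes "x > 0"
  shows "polylog_reg (- of_nat n) x = (- 1) ^ n * (deriv ^^ n) bernoulli_fun (of_real x)"
proof -
  have "rpow x (- of_nat n - 1) * rpow x (of_nat (Suc n)) = 1"
    by (simp flip: rpow_add)
  hence "rpow x (- of_nat n - 1) = 1 / of_real x ^ Suc n"
    using assms by (subst (asm) rpow_of_nat) (auto simp: field_simps)
  moreover have "Gamma (1 - - of_nat n :: complex) = fact n"
    by (simp add: Gamma_fact)
  ultimately show ?thesis
    using polylog_exp_neg_nat[of "of_real x" n] assms unfolding polylog_reg_def by simp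
qed

text \<open>
  Both \<open>polylog_exp (-N)\<close> and the subtracted power \<open>N! / y ^ (N + 1)\<close> are superpositions of exponentials
  (a sum over \<open>k\<close> and an integral over \<open>t\<close>), so one Mellin formula covers both.
\<close>

lemma polylog_reg_Mellin:
  assumes s: "0 < Re s" "Re s < real N + 1" and x: "x > 0"
  shows "integrable half_line (\<lambda>u. rpow u (s - 1) * polylog_reg (- of_nat N) (x + u))"
    and "(\<integral>u. rpow u (s - 1) * polylog_reg (- of_nat N) (x + u) \<partial>half_line) =
      Gamma s * polylog_reg (s - of_nat N) x"
proof -
  define f where "f u = rpow u (s - 1) * polylog_exp (- of_nat N) (of_real (x + u))" for u
  define g where "g u = rpow u (s - 1) * (fact N * rpow (x + u) (- of_nat N - 1))" for u
  have 1: "integrable half_line f \<and>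
      integral\<^sup>L half_line f = Gamma s * polylog_exp (s - of_nat N) (of_real x)"
  proof -
    define a where "a k = rpow (real k) (of_nat N) * exp (- of_nat k * of_real x)" for k :: nat
    have int: "integrable (count_space {1..}) (\<lambda>k. norm (a k) * real k powr (- Re s))"
    proof (rule Bochner_Integration.integrable_cong[THEN iffD1, OF refl _ integrable_powr_exp[OF x, of "real N - Re s"]])
      fix k :: nat assume "k \<in> space (count_space {1..})"
      thus "real k powr (real N - Re s) * exp (- (real k * x)) = norm (a k) * real k powr (- Re s)"
        by (simp add: a_def norm_mult norm_rpow flip: powr_add)
    qed
    have sf: "sigma_finite_measure (count_space {1..} :: nat measure)"
      by (rule sigma_finite_measure_count_space_countable) auto
    have inner: "(\<integral>k. a k * of_real (exp (- real k * u)) \<partial>count_space {1..}) =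
        polylog_exp (- of_nat N) (of_real (x + u))" for u
      unfolding polylog_exp_def a_def
      by (intro Bochner_Integration.integral_cong refl)
         (simp add: mult.assoc ring_distribs flip: exp_add exp_of_real)
    have outer: "(\<integral>k. a k * rpow (real k) (- s) \<partial>count_space {1..}) = polylog_exp (s - of_nat N) (of_real x)"
      unfolding polylog_exp_def a_def
      by (intro Bochner_Integration.integral_cong refl) (simp add: rpow_add[of _ "of_nat N" "- s", simplified])
    show ?thesis
      using Mellin_exponential_integral[OF sf _ _ _ s(1) int] unfolding inner outer f_def by simp
  qed
  have 2: "integrable half_line g \<and>
      integral\<^sup>L half_line g = Gamma s * (Gamma (1 - (s - of_nat N)) * rpow x (s - of_nat N - 1))"
  proof -
    define a where "a t = rpow t (of_nat N) * of_real (exp (- x * t))" for t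
    \<comment> \<open>Here \<open>N! / y ^ (N + 1)\<close> is the Laplace transform of
      \<open>t ^ N\<close>. Integrating out \<open>u\<close> leaves a Gamma integral in
      \<open>t\<close> with exponent \<open>w\<close>; it converges because
      \<open>Re s < N + 1\<close>.\<close>
    define w where "w = of_nat N + 1 - s"
    have w: "Re w > 0" using s by (simp add: w_def)
    have aw: "a t * rpow t (- s) = rpow t (w - 1) * of_real (exp (- x * t))" for t
      using rpow_add[of t "of_nat N" "- s"] by (simp add: a_def w_def algebra_simps)
    have int: "integrable half_line (\<lambda>t. norm (a t) * t powr (- Re s))"
    proof (rule Bochner_Integration.integrable_cong[THEN iffD1, OF refl])
      show "integrable half_line (\<lambda>t. norm (rpow t (w - 1) * of_real (exp (- x * t))))"
        by (intro integrable_norm half_line_Gamma_integral w x)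
      show "norm (rpow t (w - 1) * of_real (exp (- x * t))) = norm (a t) * t powr (- Re s)"
        if "t \<in> space half_line" for t
        unfolding aw[symmetric] using that by (simp add: norm_mult norm_rpow)
    qed
    have inner: "rpow u (s - 1) * (\<integral>t. a t * of_real (exp (- t * u)) \<partial>half_line) = g u"
      if "u \<in> space half_line" for u
    proof -
      have xu: "x + u > 0" using that x by simp
      have "(\<integral>t. a t * of_real (exp (- t * u)) \<partial>half_line) =
          (\<integral>t. rpow t (of_nat (Suc N) - 1) * of_real (exp (- (x + u) * t)) \<partial>half_line)"
        unfolding a_def by (intro Bochner_Integration.integral_cong refl)
          (simp add: mult.assoc ring_distribs mult.commute[of u] flip: exp_add exp_of_real)
      also have "\<dots> = Gamma (of_nat (Suc N)) * rpow (x + u) (- of_nat (Suc N))"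
        by (intro half_line_Gamma_integral xu) simp
      also have "Gamma (of_nat (Suc N)) = (fact N :: complex)"
        using Gamma_fact[of N, where 'a = complex] by (simp add: add.commute)
      also have "- of_nat (Suc N) = - of_nat N - (1 :: complex)" by simp
      finally show ?thesis by (simp add: g_def)
    qed
    have outer: "(\<integral>t. a t * rpow t (- s) \<partial>half_line) = Gamma w * rpow x (- w)"
      unfolding aw by (intro half_line_Gamma_integral w x)
    have [measurable]: "a \<in> borel_measurable half_line" "(\<lambda>t. t) \<in> borel_measurable half_line"
      unfolding a_def by (intro measurable_half_line; measurable)+
    note M = Mellin_exponential_integral[OF sigma_finite_half_line _ _ _ s(1) int]
    have "integrable half_line (\<lambda>u. rpow u (s - 1) * (\<integral>t. a t * of_real (exp (- t * u)) \<partial>half_line))"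
      by (rule M) auto
    hence "integrable half_line g"
      by (subst (asm) Bochner_Integration.integrable_cong[OF refl inner]) auto
    moreover have "(\<integral>u. rpow u (s - 1) * (\<integral>t. a t * of_real (exp (- t * u)) \<partial>half_line) \<partial>half_line) =
        Gamma s * (Gamma w * rpow x (- w))"
      unfolding outer[symmetric] by (rule M) auto
    hence "integral\<^sup>L half_line g = Gamma s * (Gamma w * rpow x (- w))"
      by (subst (asm) Bochner_Integration.integral_cong[OF refl inner]) auto
    ultimately show ?thesis by (simp add: w_def algebra_simps)
  qed
  have eq: "rpow u (s - 1) * polylog_reg (- of_nat N) (x + u) = f u - g u" for u
    by (simp add: polylog_reg_def f_def g_def Gamma_fact ring_distribs)
  show "integrable half_line (\<lambda>u. rpow u (s - 1) * polylog_reg (- of_nat N) (x + u))"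
    unfolding eq using 1 2 by simp
  show "(\<integral>u. rpow u (s - 1) * polylog_reg (- of_nat N) (x + u) \<partial>half_line) =
      Gamma s * polylog_reg (s - of_nat N) x"
    unfolding eq using 1 2 by (simp add: polylog_reg_def ring_distribs)
qed

lemma power_le_exp:
  assumes "y \<ge> (0::real)" "n > 0"
  shows "y ^ n \<le> (2 * real n) ^ n * exp (y / 2)"
proof -
  have "y / (2 * real n) \<le> exp (y / (2 * real n))"
    using exp_ge_add_one_self[of "y / (2 * real n)"] by linarith
  hence "(y / (2 * real n)) ^ n \<le> exp (y / (2 * real n)) ^ n"
    using assms by (intro power_mono) auto
  also have "\<dots> = exp (y / 2)"
    using assms(2) by (simp flip: exp_of_nat_mult)
  finally show ?thesis
    using assms(2) by (simp add: power_divide pos_divide_le_eq mult.commute)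
qed

lemma continuous_on_higher_deriv_bernoulli_fun:
  "continuous_on {0..1} (\<lambda>x. (deriv ^^ k) bernoulli_fun (of_real x))"
proof -
  have "continuous_on bernoulli_dom ((deriv ^^ k) bernoulli_fun)"
    by (intro holomorphic_on_imp_continuous_on holomorphic_higher_deriv
        holomorphic_bernoulli_fun open_bernoulli_dom)
  thus ?thesis
    by (rule continuous_on_compose2) (auto intro!: continuous_intros simp: bernoulli_dom_def)
qed

text \<open>On \<open>(0, 1]\<close> the function is a derivative of \<open>bernoulli_fun\<close>,
  continuous up to \<open>0\<close>. From \<open>1\<close> on the polylogarithm decays
  exponentially, so the subtracted power sets the rate \<open>y powr (- N - 1)\<close>.\<close>

lemma polylog_reg_neg_nat_bound:
  "\<exists>C\<ge>0. \<forall>y>0. norm (polylog_reg (- of_nat N) y) \<le> C \<and>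
     (1 \<le> y \<longrightarrow> norm (polylog_reg (- of_nat N) y) \<le> C * y powr (- real N - 1))"
proof -
  have "compact ((\<lambda>y. (deriv ^^ N) bernoulli_fun (of_real y)) ` {0..1})"
    by (intro compact_continuous_image continuous_on_higher_deriv_bernoulli_fun) auto
  then obtain B where B: "\<And>y. y \<in> {0..1} \<Longrightarrow> norm ((deriv ^^ N) bernoulli_fun (of_real y)) \<le> B"
    using compact_imp_bounded by (force simp: bounded_iff)
  define I where "I = (\<integral>k. real k powr (real N) * exp (- (real k * (1 / 2))) \<partial>count_space {1..})"
  define D where "D = I * (2 * real (Suc N)) ^ Suc N + fact N"
  have I: "I \<ge> 0" unfolding I_def by (intro integral_nonneg_AE) auto
  hence D: "D \<ge> 0" by (simp add: D_def)
  have far: "norm (polylog_reg (- of_nat N) y) \<le> D * y powr (- real N - 1)" if y: "y \<ge> 1" for y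
  proof -
    have pw: "y powr (- real N - 1) = 1 / y ^ Suc N"
      using y powr_realpow[of y "Suc N"] powr_minus[of y "real (Suc N)"]
      by (simp add: field_simps minus_diff_commute)
    have "norm (polylog_exp (- of_nat N) (of_real y)) \<le> I * exp (- (y / 2))"
      unfolding I_def by (rule norm_polylog_exp_le[OF y]) simp
    also have "exp (- (y / 2)) \<le> (2 * real (Suc N)) ^ Suc N * y powr (- real N - 1)"
      using power_le_exp[of y "Suc N"] y unfolding pw by (simp add: exp_minus field_simps del: power_Suc)
    finally have 1: "norm (polylog_exp (- of_nat N) (of_real y)) \<le>
        I * ((2 * real (Suc N)) ^ Suc N * y powr (- real N - 1))"
      using I by (simp add: mult_left_mono)
    have "norm (Gamma (1 - - of_nat N) * rpow y (- of_nat N - 1)) = fact N * y powr (- real N - 1)"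
      using y Gamma_fact[of N, where 'a = complex] by (simp add: norm_mult norm_rpow)
    with 1 show ?thesis
      unfolding polylog_reg_def D_def
      by (intro order.trans[OF norm_triangle_ineq4]) (simp add: ring_distribs mult.assoc)
  qed
  show ?thesis
  proof (intro exI[of _ "max B D"] conjI allI impI)
    show "max B D \<ge> 0" using D by simp
    fix y :: real assume y: "y > 0"
    show "norm (polylog_reg (- of_nat N) y) \<le> max B D"
    proof (cases "y \<ge> 1")
      case True
      have "D * y powr (- real N - 1) \<le> D * 1 powr (- real N - 1)"
        using True D by (intro mult_left_mono powr_mono2') auto
      thus ?thesis using far[OF True] by simp
    next
      case False
      thus ?thesis using B[of y] y by (simp add: polylog_reg_neg_nat norm_mult norm_power)
    qed
    assume "1 \<le> y"
    thus "norm (polylog_reg (- of_nat N) y) \<le> max B D * y powr (- real N - 1)"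
      by (intro order.trans[OF far] mult_right_mono) auto
  qed
qed

lemma integrable_half_line_powr:
  assumes "a > - 1" "b < - 1"
  shows "integrable half_line (\<lambda>u. if u \<le> 1 then u powr a else u powr b)"
proof -
  have 1: "set_integrable lborel {0<..1} (\<lambda>u. u powr a)"
  proof -
    have "(\<lambda>u. u powr a) absolutely_integrable_on {0..1}"
      using integrable_on_powr_from_0[OF assms(1), of 1]
      by (intro nonnegative_absolutely_integrable_1) auto
    hence "(\<lambda>u. u powr a) absolutely_integrable_on {0<..1}"
      by (rule set_integrable_subset) auto
    thus ?thesis
      using integrable_completion[of "\<lambda>u. indicator {0<..1} u *\<^sub>R u powr a" lborel]
      by (simp add: set_integrable_def)
  qed
  have 2: "set_integrable lborel {1..} (\<lambda>u. u powr b)"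
  proof -
    have "(\<lambda>u. u powr b) absolutely_integrable_on {1..}"
      using has_integral_powr_to_inf[of b 1] assms(2)
      by (intro nonnegative_absolutely_integrable_1) (auto simp: integrable_on_def)
    thus ?thesis
      using integrable_completion[of "\<lambda>u. indicator {1..} u *\<^sub>R u powr b" lborel]
      by (simp add: set_integrable_def)
  qed
  have 3: "set_integrable lborel {1<..} (\<lambda>u. u powr b)"
    by (rule set_integrable_subset[OF 2]) auto
  have "integrable lborel (\<lambda>u. indicator {0<..1} u *\<^sub>R u powr a + indicator {1<..} u *\<^sub>R u powr b)"
    using 1 3 by (simp add: set_integrable_def)
  also have "(\<lambda>u. indicator {0<..1} u *\<^sub>R u powr a + indicator {1<..} u *\<^sub>R u powr b) =
      (\<lambda>u. indicator {0<..} u *\<^sub>R (if u \<le> 1 then u powr a else u powr b))"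
    by (auto simp: indicator_def fun_eq_iff)
  finally show ?thesis unfolding integrable_half_line set_integrable_def .
qed

text \<open>The integrand of the Weyl integral is dominated independently of \<open>x\<close>: by
  \<open>u powr (a - 1)\<close> up to \<open>u = 1\<close>, and beyond it by
  \<open>u powr (b - 1)\<close> times the decay \<open>u powr (- N - 1)\<close>. The hypotheses on
  \<open>a\<close> and \<open>b\<close> are the integrability conditions at \<open>0\<close> and at
  infinity.\<close>

lemma polylog_reg_strip_bound:
  assumes "0 < a" "b < real N + 1"
  shows "\<exists>C\<ge>0. \<forall>s x. a \<le> Re s \<longrightarrow> Re s \<le> b \<longrightarrow> 0 < x \<longrightarrow>
    norm (polylog_reg (s - of_nat N) x) \<le> C * norm (rGamma s)"
proof -
  obtain C where C: "C \<ge> 0" "\<And>y. y > 0 \<Longrightarrow> norm (polylog_reg (- of_nat N) y) \<le> C"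
    "\<And>y. 1 \<le> y \<Longrightarrow> norm (polylog_reg (- of_nat N) y) \<le> C * y powr (- real N - 1)"
    using polylog_reg_neg_nat_bound[of N] by fastforce
  define g where "g u = (if u \<le> 1 then u powr (a - 1) else u powr (b - real N - 2))" for u :: real
  have g: "integrable half_line (\<lambda>u. C * g u)"
    unfolding g_def using assms by (intro integrable_mult_right integrable_half_line_powr) auto
  define D where "D = (\<integral>u. C * g u \<partial>half_line)"
  have "norm (polylog_reg (s - of_nat N) x) \<le> D * norm (rGamma s)"
    if s: "a \<le> Re s" "Re s \<le> b" and x: "0 < x" for s x
  proof -
    have s': "0 < Re s" "Re s < real N + 1" using s assms by auto
    note M = polylog_reg_Mellin[OF s' x]
    have "s \<notin> \<int>\<^sub>\<le>\<^sub>0" using s' by (intro not_nonpos_Int_if_Re_pos) simp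
    hence G: "rGamma s * Gamma s = 1" by (simp add: rGamma_inverse_Gamma Gamma_eq_zero_iff)
    have le: "norm (rpow u (s - 1) * polylog_reg (- of_nat N) (x + u)) \<le> C * g u"
      if "u \<in> space half_line" for u
    proof -
      have u: "u > 0" using that by simp
      show ?thesis
      proof (cases "u \<le> 1")
        case True
        have "u powr (Re s - 1) \<le> u powr (a - 1)"
          using u True s by (intro powr_mono') auto
        hence "u powr (Re s - 1) * norm (polylog_reg (- of_nat N) (x + u)) \<le> u powr (a - 1) * C"
          using u x by (intro mult_mono C) auto
        thus ?thesis using True u by (simp add: norm_mult norm_rpow g_def mult.commute)
      next
        case False
        have "norm (polylog_reg (- of_nat N) (x + u)) \<le> C * (x + u) powr (- real N - 1)"
          using False x by (intro C) auto
        also have "\<dots> \<le> C * u powr (- real N - 1)"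
          using False x C(1) by (intro mult_left_mono powr_mono2') auto
        finally have "u powr (Re s - 1) * norm (polylog_reg (- of_nat N) (x + u)) \<le>
            u powr (b - 1) * (C * u powr (- real N - 1))"
          using False s by (intro mult_mono powr_mono) auto
        also have "\<dots> = C * u powr (b - real N - 2)"
          using powr_add[of u "b - 1" "- real N - 1"] by (simp add: mult_ac)
        finally show ?thesis using False u by (simp add: norm_mult norm_rpow g_def)
      qed
    qed
    have "norm (polylog_reg (s - of_nat N) x) =
        norm (rGamma s) * norm (\<integral>u. rpow u (s - 1) * polylog_reg (- of_nat N) (x + u) \<partial>half_line)"
      using G unfolding M(2) norm_mult[symmetric] by (simp flip: mult.assoc)
    also have "norm (rGamma s) * norm (\<integral>u. rpow u (s - 1) * polylog_reg (- of_nat N) (x + u) \<partial>half_line)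
        \<le> norm (rGamma s) * D"
      unfolding D_def by (intro mult_left_mono Bochner_Integration.integral_norm_bound_integral[OF M(1) g le]) auto
    finally show ?thesis by (simp only: mult.commute)
  qed
  moreover have "D \<ge> 0"
    unfolding D_def using C(1) by (intro integral_nonneg_AE AE_I2) (auto simp: g_def)
  ultimately show ?thesis by blast
qed

lemma polylog_reg_locally_bounded:
  assumes "Re s < 1"
  shows "\<exists>r>0. \<exists>C. \<forall>t x. dist t s < r \<longrightarrow> 0 < x \<longrightarrow> norm (polylog_reg t x) \<le> C"
proof -
  \<comment> \<open>With \<open>N > 1 - Re s\<close> and \<open>r \<le> 1 / 2\<close> the shifted
    strip has \<open>a > 0\<close>; \<open>r \<le> (1 - Re s) / 2\<close> gives
    \<open>b < N + 1\<close>.\<close>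
  obtain N :: nat where N: "real N > 1 - Re s" using reals_Archimedean2 by blast
  define r where "r = min (1 / 2) ((1 - Re s) / 2)"
  have r: "r > 0" "r \<le> 1 / 2" "r \<le> (1 - Re s) / 2" using assms by (auto simp: r_def min_def)
  define a where "a = Re s + real N - r"
  define b where "b = Re s + real N + r"
  obtain C where C: "C \<ge> 0" "\<And>t x. a \<le> Re t \<Longrightarrow> Re t \<le> b \<Longrightarrow> 0 < x \<Longrightarrow>
      norm (polylog_reg (t - of_nat N) x) \<le> C * norm (rGamma t)"
    using polylog_reg_strip_bound[of a b N] r N assms unfolding a_def b_def by (auto simp: field_simps)
  have "compact (rGamma ` cball (s + of_nat N) r)"
    by (intro compact_continuous_image holomorphic_on_imp_continuous_on holomorphic_rGamma compact_cball)
  then obtain B where B: "\<And>t. t \<in> cball (s + of_nat N) r \<Longrightarrow> norm (rGamma t) \<le> B"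
    using compact_imp_bounded by (force simp: bounded_iff)
  have "norm (polylog_reg t x) \<le> C * B" if t: "dist t s < r" and x: "0 < x" for t x
  proof -
    have "\<bar>Re t - Re s\<bar> \<le> r"
      using t abs_Re_le_cmod[of "t - s"] by (simp add: dist_norm)
    hence "norm (polylog_reg (t + of_nat N - of_nat N) x) \<le> C * norm (rGamma (t + of_nat N))"
      using x by (intro C) (auto simp: a_def b_def)
    also have "\<dots> \<le> C * B"
      using t C(1) by (intro mult_left_mono B) (auto simp: dist_norm norm_minus_commute)
    finally show ?thesis by simp
  qed
  with r(1) show ?thesis by blast
qed

lemma holomorphic_polylog_reg:
  assumes "x > 0"
  shows "(\<lambda>s. polylog_reg s x) holomorphic_on {s. Re s < 1}"
  unfolding polylog_reg_def
  using assms by (intro holomorphic_intros holomorphic_on_subset[OF holomorphic_polylog_exp])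
    (auto intro!: not_nonpos_Int_if_Re_pos)

text \<open>The subtracted powers form a family closed under differentiation as well, by the
  functional equation \<open>Gamma (2 - s) = (1 - s) * Gamma (1 - s)\<close>.\<close>

lemma has_vector_derivative_polylog_reg:
  assumes "x > 0" "Re s < 1"
  shows "(polylog_reg s has_vector_derivative - polylog_reg (s - 1) x) (at x within A)"
proof -
  have "Gamma (1 - s + 1) = (1 - s) * Gamma (1 - s)"
    using assms(2) by (intro Gamma_plus1 not_nonpos_Int_if_Re_pos) simp
  hence G: "Gamma (1 - (s - 1)) = (1 - s) * Gamma (1 - s)" by (simp add: algebra_simps)
  have "(polylog_exp s has_field_derivative - polylog_exp (s - 1) (of_real x)) (at (of_real x))"
    using assms(1) by (intro has_field_derivative_polylog_exp) simp
  hence 1: "((\<lambda>x. polylog_exp s (of_real x)) has_vector_derivative - polylog_exp (s - 1) (of_real x)) (at x within A)"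
    by (rule has_vector_derivative_real_field)
  have "((\<lambda>x. polylog_exp s (of_real x) - Gamma (1 - s) * rpow x (s - 1)) has_vector_derivative
      - polylog_exp (s - 1) (of_real x) - Gamma (1 - s) * ((s - 1) * rpow x (s - 1 - 1))) (at x within A)"
    using assms(1) by (intro has_vector_derivative_diff 1 has_vector_derivative_mult_right has_vector_derivative_rpow)
  also have "- polylog_exp (s - 1) (of_real x) - Gamma (1 - s) * ((s - 1) * rpow x (s - 1 - 1)) =
      - polylog_reg (s - 1) x"
    unfolding polylog_reg_def G by (simp add: algebra_simps)
  finally show ?thesis unfolding polylog_reg_def[abs_def] .
qed

section \<open>Regularized moments\<close>

text \<open>The point \<open>0\<close> is left out because the integrands are controlled only for
  \<open>x > 0\<close>.\<close>

definition unit_interval :: "real measure" where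
  "unit_interval = restrict_space lborel {0<..1}"

lemma space_unit_interval [simp]: "space unit_interval = {0<..1}"
  by (simp add: unit_interval_def space_restrict_space)

lemma integrable_unit_interval: "integrable unit_interval f \<longleftrightarrow> set_integrable lborel {0<..1} f"
  for f :: "real \<Rightarrow> 'b::{banach, second_countable_topology}"
  unfolding unit_interval_def set_integrable_def by (rule integrable_restrict_space) auto

lemma integral_unit_interval: "integral\<^sup>L unit_interval f = (LINT x:{0<..1}|lborel. f x)"
  for f :: "real \<Rightarrow> 'b::{banach, second_countable_topology}"
  unfolding unit_interval_def set_lebesgue_integral_def by (rule integral_restrict_space) auto

lemma measurable_unit_interval_continuous:
  fixes f :: "real \<Rightarrow> complex"
  assumes "continuous_on {0<..1} f"
  shows "f \<in> borel_measurable unit_interval"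
  using borel_measurable_continuous_on_restrict[OF assms]
  by (subst measurable_cong_sets[OF _ refl, of _ "restrict_space borel {0<..1}"])
     (simp_all add: unit_interval_def sets_restrict_space)

lemma integrable_unit_interval_powr:
  assumes "a > - 1"
  shows "integrable unit_interval (\<lambda>x. x powr a)"
proof -
  have "(\<lambda>u. u powr a) absolutely_integrable_on {0..1}"
    using integrable_on_powr_from_0[OF assms, of 1]
    by (intro nonnegative_absolutely_integrable_1) auto
  hence "(\<lambda>u. u powr a) absolutely_integrable_on {0<..1}"
    by (rule set_integrable_subset) auto
  thus ?thesis
    using integrable_completion[of "\<lambda>u. indicator {0<..1} u *\<^sub>R u powr a" lborel]
    by (simp add: set_integrable_def integrable_unit_interval)
qed

lemma integral_unit_interval_FTC:
  fixes F f :: "real \<Rightarrow> complex"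
  assumes "continuous_on {0..1} F"
    and "\<And>x. 0 < x \<Longrightarrow> x < 1 \<Longrightarrow> (F has_vector_derivative f x) (at x)"
    and "integrable unit_interval f"
  shows "integral\<^sup>L unit_interval f = F 1 - F 0"
proof -
  have "(f has_integral (F 1 - F 0)) {0..1}"
    using assms by (intro fundamental_theorem_of_calculus_interior) auto
  hence "integral {0..1} f = F 1 - F 0" by (rule integral_unique)
  also have "integral {0..1} f = integral {0<..1} f"
    by (rule integral_spike_set; rule negligible_subset[of "{0}"]) auto
  finally have "integral {0<..1} f = F 1 - F 0" .
  moreover have "(LINT x:{0<..1}|lborel. f x) = integral {0<..1} f"
    using assms(3) unfolding integrable_unit_interval by (rule set_borel_integral_eq_integral)
  ultimately show ?thesis by (simp add: integral_unit_interval)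
qed

text \<open>A function \<open>h 0\<close> together with all its derivatives, each bounded near
  \<open>0\<close>. Carrying the whole sequence avoids iterated derivative operators for functions
  of a real variable. Differentiability on all of \<open>(0, \<infinity>)\<close> covers the
  endpoint \<open>1\<close>.\<close>

definition deriv_chain :: "(nat \<Rightarrow> real \<Rightarrow> complex) \<Rightarrow> bool" where
  "deriv_chain h \<longleftrightarrow>
     (\<forall>m x. 0 < x \<longrightarrow> (h m has_vector_derivative h (Suc m) x) (at x)) \<and>
     (\<forall>m. \<exists>C. \<forall>x. 0 < x \<longrightarrow> x \<le> 1 \<longrightarrow> norm (h m x) \<le> C)"

lemma deriv_chainD:
  assumes "deriv_chain h"
  shows "0 < x \<Longrightarrow> (h m has_vector_derivative h (Suc m) x) (at x)"
    and "\<exists>C. \<forall>x. 0 < x \<longrightarrow> x \<le> 1 \<longrightarrow> norm (h m x) \<le> C"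
    and "continuous_on {0<..} (h m)"
proof -
  show D: "0 < x \<Longrightarrow> (h m has_vector_derivative h (Suc m) x) (at x)" for x
    using assms by (auto simp: deriv_chain_def)
  show "\<exists>C. \<forall>x. 0 < x \<longrightarrow> x \<le> 1 \<longrightarrow> norm (h m x) \<le> C"
    using assms by (auto simp: deriv_chain_def)
  show "continuous_on {0<..} (h m)"
    by (intro continuous_at_imp_continuous_on ballI has_vector_derivative_continuous[OF D]) auto
qed

definition unit_moment :: "complex \<Rightarrow> (real \<Rightarrow> complex) \<Rightarrow> complex" where
  "unit_moment w f = (\<integral>x. rpow x (w - 1) * f x \<partial>unit_interval)"

lemma integrable_unit_moment:
  assumes "Re w > 0" "continuous_on {0<..1} f" "\<And>x. 0 < x \<Longrightarrow> x \<le> 1 \<Longrightarrow> norm (f x) \<le> C"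
  shows "integrable unit_interval (\<lambda>x. rpow x (w - 1) * f x)"
proof (rule Bochner_Integration.integrable_bound)
  show "integrable unit_interval (\<lambda>x. x powr (Re w - 1) * C)"
    using assms(1) by (intro integrable_mult_left integrable_unit_interval_powr) auto
  show "(\<lambda>x. rpow x (w - 1) * f x) \<in> borel_measurable unit_interval"
    by (intro measurable_unit_interval_continuous continuous_intros assms) auto
  show "AE x in unit_interval. norm (rpow x (w - 1) * f x) \<le> norm (x powr (Re w - 1) * C)"
    using assms(3) by (intro AE_I2) (auto simp: norm_mult norm_rpow intro!: mult_left_mono order.trans[OF _ abs_ge_self])
qed

text \<open>
  Since \<open>rGamma w = w * rGamma (w + 1)\<close>, this is \<open>rGamma w\<close> times the moment
  of \<open>x powr (w - 1) * h 0 x\<close> over \<open>(0, 1]\<close> after \<open>M\<close> integrations by parts. It makes sense for \<open>Re w > -M\<close>.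
\<close>

definition regularized_moment :: "nat \<Rightarrow> complex \<Rightarrow> (nat \<Rightarrow> real \<Rightarrow> complex) \<Rightarrow> complex" where
  "regularized_moment M w h =
     (\<Sum>m<M. (- 1) ^ m * h m 1 * rGamma (w + of_nat m + 1)) +
     (- 1) ^ M * rGamma (w + of_nat M) * unit_moment (w + of_nat M) (h M)"

lemma regularized_moment_0: "regularized_moment 0 w h = rGamma w * unit_moment w (h 0)"
  by (simp add: regularized_moment_def)

lemma unit_moment_by_parts:
  assumes h: "deriv_chain h" and w: "Re w > 0"
  shows "w * unit_moment w (h m) = h m 1 - unit_moment (w + 1) (h (Suc m))"
proof -
  obtain C where C: "\<And>x. 0 < x \<Longrightarrow> x \<le> 1 \<Longrightarrow> norm (h m x) \<le> C"
    using deriv_chainD(2)[OF h] by blast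
  obtain C' where C': "\<And>x. 0 < x \<Longrightarrow> x \<le> 1 \<Longrightarrow> norm (h (Suc m) x) \<le> C'"
    using deriv_chainD(2)[OF h] by blast
  have cont: "continuous_on {0<..1} (h k)" for k
    by (rule continuous_on_subset[OF deriv_chainD(3)[OF h]]) auto
  have w1: "Re (w + 1) > 0" using w by simp
  note I1 = integrable_unit_moment[OF w cont C]
  note I2 = integrable_unit_moment[OF w1 cont C']
  \<comment> \<open>The value at \<open>0\<close> is set by hand, since \<open>rpow 0 w\<close> is
    \<open>1\<close> and not the limit \<open>0\<close>. Boundedness of \<open>h m\<close> and
    \<open>Re w > 0\<close> make \<open>F\<close> continuous there, so no boundary term arises at
    \<open>0\<close>.\<close>
  define F where "F x = (if x = 0 then 0 else rpow x w * h m x)" for x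
  have "continuous_on {0..1} F"
  proof (rule continuous_on_eq_continuous_within[THEN iffD2], rule ballI)
    fix x :: real assume x: "x \<in> {0..1}"
    show "continuous (at x within {0..1}) F"
    proof (cases "x = 0")
      case True
      have nonneg: "eventually (\<lambda>x. x \<ge> (0::real)) (at 0 within {0..1})"
        by (auto simp: eventually_at_filter)
      have "((\<lambda>x. x powr Re w * C) \<longlongrightarrow> 0 powr Re w * C) (at 0 within {0..1})"
        using w nonneg by (intro tendsto_intros) auto
      hence "((\<lambda>x. x powr Re w * C) \<longlongrightarrow> 0) (at 0 within {0..1})" by simp
      moreover have "eventually (\<lambda>x. norm (F x) \<le> x powr Re w * C) (at 0 within {0..1})"
        using C by (auto simp: eventually_at_filter F_def norm_mult norm_rpow intro!: always_eventually mult_left_mono)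
      ultimately have "(F \<longlongrightarrow> 0) (at 0 within {0..1})"
        by (rule Lim_null_comparison[rotated])
      thus ?thesis using True by (simp add: continuous_within F_def)
    next
      case False
      have "continuous_on {0<..} (\<lambda>x. rpow x w * h m x)"
        by (intro continuous_intros deriv_chainD(3)[OF h]) auto
      hence "continuous_on {0<..} F"
        by (subst continuous_on_cong[OF refl, of _ F "\<lambda>x. rpow x w * h m x"]) (auto simp: F_def)
      hence "continuous (at x) F"
        using x False by (subst (asm) continuous_on_eq_continuous_at) auto
      thus ?thesis by (rule continuous_at_imp_continuous_at_within)
    qed
  qed
  moreover have "(F has_vector_derivative
      w * (rpow x (w - 1) * h m x) + rpow x (w + 1 - 1) * h (Suc m) x) (at x)" if "0 < x" for x
  proof -
    have "((\<lambda>x. rpow x w * h m x) has_vector_derivative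
        rpow x w * h (Suc m) x + w * rpow x (w - 1) * h m x) (at x)"
      using that by (intro has_vector_derivative_mult has_vector_derivative_rpow deriv_chainD(1)[OF h])
    hence "((\<lambda>x. rpow x w * h m x) has_vector_derivative
        w * (rpow x (w - 1) * h m x) + rpow x (w + 1 - 1) * h (Suc m) x) (at x)"
      by (simp add: algebra_simps)
    thus ?thesis
      by (rule has_vector_derivative_transform_within_open[of _ _ _ "{0<..}"])
         (use that in \<open>auto simp: F_def\<close>)
  qed
  ultimately have "(\<integral>x. w * (rpow x (w - 1) * h m x) + rpow x (w + 1 - 1) * h (Suc m) x \<partial>unit_interval) =
      F 1 - F 0"
    using I1 I2 by (intro integral_unit_interval_FTC Bochner_Integration.integrable_add integrable_mult_right) auto
  also have "(\<integral>x. w * (rpow x (w - 1) * h m x) + rpow x (w + 1 - 1) * h (Suc m) x \<partial>unit_interval) =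
      w * unit_moment w (h m) + unit_moment (w + 1) (h (Suc m))"
    unfolding unit_moment_def
    by (subst Bochner_Integration.integral_add[OF integrable_mult_right[OF I1] I2]) simp_all
  finally show ?thesis by (simp add: F_def algebra_simps)
qed

text \<open>One more integration by parts. The value is therefore independent of \<open>M\<close>
  wherever it makes sense, which is the analytic continuation in \<open>w\<close>.\<close>

lemma regularized_moment_Suc:
  assumes "deriv_chain h" "Re w > - real M"
  shows "regularized_moment (Suc M) w h = regularized_moment M w h"
proof -
  define v where "v = w + of_nat M"
  have "rGamma v * unit_moment v (h M) = rGamma (v + 1) * (v * unit_moment v (h M))"
    using rGamma_plus1[of v] by (simp add: mult_ac)
  also have "\<dots> = rGamma (v + 1) * (h M 1 - unit_moment (v + 1) (h (Suc M)))"
    using assms by (subst unit_moment_by_parts) (auto simp: v_def)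
  finally have 1: "rGamma v * unit_moment v (h M) =
      rGamma (v + 1) * (h M 1 - unit_moment (v + 1) (h (Suc M)))" .
  have 2: "w + of_nat (Suc M) = v + 1" by (simp add: v_def)
  show ?thesis
    unfolding regularized_moment_def sum.lessThan_Suc 2 v_def[symmetric] mult.assoc 1
    by (simp add: algebra_simps)
qed

lemma regularized_moment_eq_0:
  assumes "deriv_chain h" "Re w > 0"
  shows "regularized_moment M w h = rGamma w * unit_moment w (h 0)"
proof (induction M)
  case (Suc M)
  thus ?case using assms by (subst regularized_moment_Suc) auto
qed (simp add: regularized_moment_0)

text \<open>At \<open>w = -n\<close> the zeros of \<open>rGamma\<close> remove the boundary terms
  with \<open>m < n\<close>. After \<open>n + 1\<close> integrations by parts the weight is
  \<open>x powr 0\<close>, so the remaining moment is \<open>g 1 - g 0\<close>, and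
  \<open>g 1\<close> cancels the boundary term with \<open>m = n\<close>. The function
  \<open>g\<close> supplies the continuous extension of \<open>h n\<close> to
  \<open>0\<close>.\<close>

lemma regularized_moment_neg_nat:
  assumes h: "deriv_chain h" and g: "continuous_on {0..1} g"
    and eq: "\<And>x. 0 < x \<Longrightarrow> x \<le> 1 \<Longrightarrow> h n x = g x"
  shows "regularized_moment (Suc n) (- of_nat n) h = (- 1) ^ n * g 0"
proof -
  have "(\<Sum>m<n. (- 1) ^ m * h m 1 * rGamma (- of_nat n + of_nat m + 1 :: complex)) = 0"
  proof (intro sum.neutral ballI)
    fix m assume "m \<in> {..<n}"
    hence "- of_nat n + of_nat m + 1 = - (of_nat (n - Suc m) :: complex)"
      by (simp add: of_nat_diff)
    thus "(- 1) ^ m * h m 1 * rGamma (- of_nat n + of_nat m + 1 :: complex) = 0"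
      by (simp add: rGamma_eq_zero_iff)
  qed
  hence 1: "regularized_moment (Suc n) (- of_nat n) h = (- 1) ^ n * h n 1 - (- 1) ^ n * unit_moment 1 (h (Suc n))"
    by (simp add: regularized_moment_def)
  obtain C where C: "\<And>x. 0 < x \<Longrightarrow> x \<le> 1 \<Longrightarrow> norm (h (Suc n) x) \<le> C"
    using deriv_chainD(2)[OF h] by blast
  have cont: "continuous_on {0<..1} (h (Suc n))"
    by (rule continuous_on_subset[OF deriv_chainD(3)[OF h]]) auto
  have "integrable unit_interval (\<lambda>x. rpow x (1 - 1) * h (Suc n) x)"
    by (rule integrable_unit_moment[OF _ cont C]) auto
  moreover have "(g has_vector_derivative h (Suc n) x) (at x)" if "0 < x" "x < 1" for x
    by (rule has_vector_derivative_transform_within_open[OF deriv_chainD(1)[OF h that(1)], of "{0<..<1}"])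
       (use that eq in auto)
  ultimately have "unit_moment 1 (h (Suc n)) = g 1 - g 0"
    unfolding unit_moment_def using g by (intro integral_unit_interval_FTC) auto
  with 1 show ?thesis using eq[of 1] by (simp add: algebra_simps)
qed

lemma holomorphic_regularized_moment:
  assumes S: "open S" and w: "w holomorphic_on S" and wM: "\<And>s. s \<in> S \<Longrightarrow> Re (w s) > - real M"
    and hol: "\<And>m x. 0 < x \<Longrightarrow> (\<lambda>s. h s m x) holomorphic_on S"
    and chain: "\<And>s. s \<in> S \<Longrightarrow> deriv_chain (h s)"
    and bd: "\<And>s m. s \<in> S \<Longrightarrow> \<exists>r>0. \<exists>C. \<forall>t x. dist t s < r \<longrightarrow> 0 < x \<longrightarrow> x \<le> 1 \<longrightarrow> norm (h t m x) \<le> C"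
  shows "(\<lambda>s. regularized_moment M (w s) (h s)) holomorphic_on S"
proof -
  have "(\<lambda>s. \<integral>x. rpow x (w s + of_nat M - 1) * h s M x \<partial>unit_interval) holomorphic_on S"
  proof (rule holomorphic_on_lebesgue_integral[OF S])
    show "(\<lambda>s. rpow x (w s + of_nat M - 1) * h s M x) holomorphic_on S" if "x \<in> space unit_interval" for x
      using that by (intro holomorphic_intros w hol) auto
    show "(\<lambda>x. rpow x (w s + of_nat M - 1) * h s M x) \<in> borel_measurable unit_interval" if "s \<in> S" for s
      by (intro measurable_unit_interval_continuous continuous_intros
          continuous_on_subset[OF deriv_chainD(3)[OF chain[OF that]]]) auto
    fix s assume s: "s \<in> S"
    \<comment> \<open>Half of the available room: near \<open>s\<close> the exponent still satisfies
      \<open>Re (w t) + M > c\<close>, so \<open>x powr (c - 1)\<close> is an integrable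
      majorant.\<close>
    define c where "c = (Re (w s) + real M) / 2"
    have c: "c > 0" using wM[OF s] by (simp add: c_def)
    obtain r1 C where r1: "r1 > 0"
      and C: "\<And>t x. dist t s < r1 \<Longrightarrow> 0 < x \<Longrightarrow> x \<le> 1 \<Longrightarrow> norm (h t M x) \<le> C"
      using bd[OF s, of M] by blast
    have "isCont w s"
      using holomorphic_on_imp_continuous_on[OF w] S s by (simp add: continuous_on_eq_continuous_at)
    then obtain r2 where r2: "r2 > 0" "\<And>t. dist t s < r2 \<Longrightarrow> dist (w t) (w s) < c"
      using c unfolding continuous_at_eps_delta by blast
    show "\<exists>r>0. \<exists>g. integrable unit_interval g \<and> (\<forall>t\<in>S. dist t s < r \<longrightarrow>
        (\<forall>x\<in>space unit_interval. norm (rpow x (w t + of_nat M - 1) * h t M x) \<le> g x))"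
    proof (intro exI[of _ "min r1 r2"] conjI exI[of _ "\<lambda>x. x powr (c - 1) * C"] ballI impI)
      show "integrable unit_interval (\<lambda>x. x powr (c - 1) * C)"
        using c by (intro integrable_mult_left integrable_unit_interval_powr) auto
      fix t x assume t: "t \<in> S" "dist t s < min r1 r2" and x: "x \<in> space unit_interval"
      have "\<bar>Re (w t) - Re (w s)\<bar> < c"
        using r2(2)[of t] t(2) abs_Re_le_cmod[of "w t - w s"] by (simp add: dist_norm)
      moreover have "Re (w s) + real M = 2 * c" by (simp add: c_def)
      ultimately have "x powr (Re (w t) + real M - 1) \<le> x powr (c - 1)"
        using x by (intro powr_mono') auto
      hence "x powr (Re (w t) + real M - 1) * norm (h t M x) \<le> x powr (c - 1) * C"
        using x t by (intro mult_mono C) auto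
      thus "norm (rpow x (w t + of_nat M - 1) * h t M x) \<le> x powr (c - 1) * C"
        using x by (simp add: norm_mult norm_rpow)
    qed (use r1 r2 in auto)
  qed
  thus ?thesis
    unfolding regularized_moment_def unit_moment_def
    by (intro holomorphic_intros w hol) auto
qed

text \<open>The successive derivatives of \<^term>\<open>polylog_reg s\<close> on \<open>(0, \<infinity>)\<close>.\<close>

definition reg_chain :: "complex \<Rightarrow> nat \<Rightarrow> real \<Rightarrow> complex" where
  "reg_chain s m x = (- 1) ^ m * polylog_reg (s - of_nat m) x"

definition prod_chain :: "(nat \<Rightarrow> real \<Rightarrow> complex) \<Rightarrow> (nat \<Rightarrow> real \<Rightarrow> complex) \<Rightarrow> nat \<Rightarrow> real \<Rightarrow> complex" where
  "prod_chain a b m x = (\<Sum>i\<le>m. of_nat (m choose i) * (a i x * b (m - i) x))"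

text \<open>Pascal's rule, splitting the Leibniz sum according to which factor receives the last
  derivative.\<close>

lemma prod_chain_Suc:
  "prod_chain a b (Suc m) x = prod_chain (\<lambda>i. a (Suc i)) b m x + prod_chain a (\<lambda>i. b (Suc i)) m x"
proof -
  have "prod_chain a b (Suc m) x =
      a 0 x * b (Suc m) x + (\<Sum>i\<le>m. of_nat (Suc m choose Suc i) * (a (Suc i) x * b (m - i) x))"
    unfolding prod_chain_def by (subst sum.atMost_Suc_shift) simp
  also have "(\<Sum>i\<le>m. of_nat (Suc m choose Suc i) * (a (Suc i) x * b (m - i) x)) =
      prod_chain (\<lambda>i. a (Suc i)) b m x + (\<Sum>i\<le>m. of_nat (m choose Suc i) * (a (Suc i) x * b (m - i) x))"
    by (simp add: prod_chain_def ring_distribs sum.distrib)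
  also have "a 0 x * b (Suc m) x + (\<dots>) = prod_chain (\<lambda>i. a (Suc i)) b m x +
      (a 0 x * b (Suc m) x + (\<Sum>i\<le>m. of_nat (m choose Suc i) * (a (Suc i) x * b (m - i) x)))"
    by simp
  also have "a 0 x * b (Suc m) x + (\<Sum>i\<le>m. of_nat (m choose Suc i) * (a (Suc i) x * b (m - i) x)) =
      (\<Sum>i\<le>Suc m. of_nat (m choose i) * (a i x * b (Suc m - i) x))"
    by (subst sum.atMost_Suc_shift) simp
  also have "\<dots> = (\<Sum>i\<le>m. of_nat (m choose i) * (a i x * b (Suc m - i) x))"
    by simp
  also have "\<dots> = prod_chain a (\<lambda>i. b (Suc i)) m x"
    unfolding prod_chain_def by (intro sum.cong) (auto simp: Suc_diff_le)
  finally show ?thesis .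
qed

lemma deriv_chain_prod:
  assumes a: "deriv_chain a" and b: "deriv_chain b"
  shows "deriv_chain (prod_chain a b)"
  unfolding deriv_chain_def
proof (intro conjI allI impI)
  fix m :: nat and x :: real assume x: "0 < x"
  have "(prod_chain a b m has_vector_derivative
      (\<Sum>i\<le>m. of_nat (m choose i) * (a i x * b (Suc (m - i)) x + a (Suc i) x * b (m - i) x))) (at x)"
    unfolding prod_chain_def[abs_def] using x
    by (intro has_vector_derivative_sum has_vector_derivative_mult_right has_vector_derivative_mult
        deriv_chainD(1)[OF a] deriv_chainD(1)[OF b])
  also have "(\<Sum>i\<le>m. of_nat (m choose i) * (a i x * b (Suc (m - i)) x + a (Suc i) x * b (m - i) x)) =
      prod_chain a b (Suc m) x"
    unfolding prod_chain_Suc by (simp add: prod_chain_def ring_distribs sum.distrib)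
  finally show "(prod_chain a b m has_vector_derivative prod_chain a b (Suc m) x) (at x)" .
next
  fix m
  obtain A where A: "\<And>i x. 0 < x \<Longrightarrow> x \<le> 1 \<Longrightarrow> norm (a i x) \<le> A i"
    using deriv_chainD(2)[OF a] by metis
  obtain B where B: "\<And>i x. 0 < x \<Longrightarrow> x \<le> 1 \<Longrightarrow> norm (b i x) \<le> B i"
    using deriv_chainD(2)[OF b] by metis
  have "A i \<ge> 0" for i using A[of 1 i] norm_ge_zero[of "a i 1"] by linarith
  hence "norm (prod_chain a b m x) \<le> (\<Sum>i\<le>m. of_nat (m choose i) * (A i * B (m - i)))"
    if "0 < x" "x \<le> 1" for x
    unfolding prod_chain_def using that
    by (intro sum_norm_le) (auto simp: norm_mult intro!: mult_left_mono mult_mono A B)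
  thus "\<exists>C. \<forall>x. 0 < x \<longrightarrow> x \<le> 1 \<longrightarrow> norm (prod_chain a b m x) \<le> C" by blast
qed

lemma reg_chain_locally_bounded:
  assumes "Re s < 1"
  shows "\<exists>r>0. \<exists>C. \<forall>t x. dist t s < r \<longrightarrow> 0 < x \<longrightarrow> x \<le> 1 \<longrightarrow> norm (reg_chain t m x) \<le> C"
proof -
  have "Re (s - of_nat m) < 1" using assms by simp
  then obtain r C where r: "r > 0"
    "\<And>t x. dist t (s - of_nat m) < r \<Longrightarrow> 0 < x \<Longrightarrow> norm (polylog_reg t x) \<le> C"
    using polylog_reg_locally_bounded by blast
  have "norm (reg_chain t m x) \<le> C" if "dist t s < r" "0 < x" for t x
    using r(2)[of "t - of_nat m" x] that by (simp add: reg_chain_def norm_mult norm_power dist_norm)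
  with r(1) show ?thesis by blast
qed

lemma deriv_chain_reg:
  assumes "Re s < 1"
  shows "deriv_chain (reg_chain s)"
  unfolding deriv_chain_def
proof (intro conjI allI impI)
  fix m :: nat and x :: real assume "0 < x"
  hence "(reg_chain s m has_vector_derivative (- 1) ^ m * (- polylog_reg (s - of_nat m - 1) x)) (at x)"
    unfolding reg_chain_def[abs_def] using assms
    by (intro has_vector_derivative_mult_right has_vector_derivative_polylog_reg) auto
  thus "(reg_chain s m has_vector_derivative reg_chain s (Suc m) x) (at x)"
    by (simp add: reg_chain_def algebra_simps)
next
  fix m
  show "\<exists>C. \<forall>x. 0 < x \<longrightarrow> x \<le> 1 \<longrightarrow> norm (reg_chain s m x) \<le> C"
    using reg_chain_locally_bounded[OF assms, of m] by (metis dist_self)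
qed

lemma holomorphic_reg_chain:
  assumes "x > 0"
  shows "(\<lambda>s. reg_chain s m x) holomorphic_on {s. Re s < 1}"
proof -
  have "(\<lambda>s. polylog_reg (s - of_nat m) x) holomorphic_on {s. Re s < 1}"
    by (rule holomorphic_on_compose_gen[OF _ holomorphic_polylog_reg[OF assms], unfolded o_def])
       (auto intro!: holomorphic_intros)
  thus ?thesis unfolding reg_chain_def by (intro holomorphic_intros)
qed

lemma prod_reg_chain_locally_bounded:
  assumes "Re s < 1"
  shows "\<exists>r>0. \<exists>C. \<forall>t x. dist t s < r \<longrightarrow> 0 < x \<longrightarrow> x \<le> 1 \<longrightarrow>
    norm (prod_chain (reg_chain t) (reg_chain t) m x) \<le> C"
proof -
  obtain r A where r: "\<And>i. r i > 0"
    and A: "\<And>i t x. dist t s < r i \<Longrightarrow> 0 < x \<Longrightarrow> x \<le> 1 \<Longrightarrow> norm (reg_chain t i x) \<le> A i"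
    using reg_chain_locally_bounded[OF assms] by metis
  have A0: "A i \<ge> 0" for i using order.trans[OF norm_ge_zero A[of s i 1]] r[of i] by simp
  define r' where "r' = Min (r ` {..m})"
  have r': "r' > 0" "\<And>i. i \<le> m \<Longrightarrow> r' \<le> r i"
    using r by (auto simp: r'_def)
  have "norm (prod_chain (reg_chain t) (reg_chain t) m x) \<le> (\<Sum>i\<le>m. of_nat (m choose i) * (A i * A (m - i)))"
    if "dist t s < r'" "0 < x" "x \<le> 1" for t x
    unfolding prod_chain_def
  proof (intro sum_norm_le)
    fix i assume i: "i \<in> {..m}"
    have "norm (reg_chain t i x) \<le> A i" "norm (reg_chain t (m - i) x) \<le> A (m - i)"
      using that i r'(2)[of i] r'(2)[of "m - i"] by (auto intro!: A)
    thus "norm (of_nat (m choose i) * (reg_chain t i x * reg_chain t (m - i) x)) \<le>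
        of_nat (m choose i) * (A i * A (m - i))"
      by (auto simp: norm_mult intro!: mult_left_mono mult_mono A0)
  qed
  with r'(1) show ?thesis by blast
qed

section \<open>Analytic continuation\<close>

definition pair_indices :: "(nat \<times> nat) set" where
  "pair_indices = {1..} \<times> {1..}"

lemma mem_pair_indices [simp]: "(j, k) \<in> pair_indices \<longleftrightarrow> j \<ge> 1 \<and> k \<ge> 1"
  by (simp add: pair_indices_def)

lemma integral_count_space_product:
  fixes f g :: "nat \<Rightarrow> 'b::{banach, real_normed_field, second_countable_topology}"
  assumes "integrable (count_space {1..}) f" "integrable (count_space {1..}) g"
  shows "integrable (count_space pair_indices) (\<lambda>(j, k). f j * g k)"
    and "(\<integral>(j, k). f j * g k \<partial>count_space pair_indices) =
      integral\<^sup>L (count_space {1..}) f * integral\<^sup>L (count_space {1..}) g"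
  using abs_summable_on_product[of "{1..}" "{1..}" f g] infsetsum_product[of "{1..}" "{1..}" f g] assms
  by (simp_all add: abs_summable_on_def infsetsum_def pair_indices_def)

lemma sigma_finite_pair_indices: "sigma_finite_measure (count_space pair_indices)"
  by (rule sigma_finite_measure_count_space_countable) (auto simp: pair_indices_def)

lemma omega_term_eq_rpow:
  assumes "j \<ge> 1" "k \<ge> 1"
  shows "omega_term s (j, k) = rpow (real j) (- s) * rpow (real k) (- s) * rpow (real (j + k)) (- s)"
proof -
  have "omega_term s (j, k) = rpow (real j * real k * real (j + k)) (- s)"
    using assms by (subst rpow_eq) (auto simp: omega_term_def)
  thus ?thesis using assms by (simp add: rpow_mult)
qed

text \<open>By the inequality of arithmetic and geometric means
  \<open>j + k \<ge> sqrt (j k)\<close>, so \<open>j k (j + k) \<ge> (j k) powr (3 / 2)\<close>. The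
  bound separates the variables; the exponent \<open>3 a / 2\<close> exceeds \<open>1\<close>
  exactly when \<open>a > 2 / 3\<close>.\<close>

lemma norm_omega_term_le:
  assumes "j \<ge> 1" "k \<ge> 1" "Re s \<ge> a" "a \<ge> 0"
  shows "norm (omega_term s (j, k)) \<le> real j powr (- (3 * a / 2)) * real k powr (- (3 * a / 2))"
proof -
  define y where "y = sqrt (real j) * sqrt (real k)"
  have jk: "real j \<ge> 1" "real k \<ge> 1" using assms by auto
  have y1: "y \<ge> 1" unfolding y_def using jk mult_mono[of 1 "sqrt (real j)" 1 "sqrt (real k)"] by simp
  have y2: "y ^ 2 = real j * real k" by (simp add: y_def power_mult_distrib)
  have "y \<le> real (j + k)"
    using arith_geo_mean_sqrt[of "real j" "real k"] by (simp add: y_def real_sqrt_mult)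
  hence "y ^ 3 \<le> real j * real k * real (j + k)"
    using y1 unfolding y2[symmetric] by (simp add: power3_eq_cube power2_eq_square mult_left_mono)
  moreover have "y ^ 3 = y powr 3" using y1 powr_realpow[of y 3] by simp
  ultimately have y3: "y powr 3 \<le> real j * real k * real (j + k)" by simp
  have one: "1 \<le> y powr 3" using y1 by (intro ge_one_powr_ge_zero) auto
  have "norm (omega_term s (j, k)) = (real j * real k * real (j + k)) powr (- Re s)"
    using assms by (simp add: omega_term_eq_rpow norm_mult norm_rpow powr_mult)
  also have "\<dots> \<le> (real j * real k * real (j + k)) powr (- a)"
    using assms one y3 by (intro powr_mono) auto
  also have "\<dots> \<le> (y powr 3) powr (- a)"
    using y3 y1 assms by (intro powr_mono2') auto
  also have "\<dots> = (y powr 2) powr (- (3 * a / 2))"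
    by (simp add: powr_powr)
  also have "y powr 2 = real j * real k" using y1 y2 powr_realpow[of y 2] by simp
  also have "(real j * real k) powr (- (3 * a / 2)) = real j powr (- (3 * a / 2)) * real k powr (- (3 * a / 2))"
    by (simp add: powr_mult)
  finally show ?thesis .
qed

lemma integrable_pair_bound:
  assumes "a > 2 / 3"
  shows "integrable (count_space pair_indices)
    (\<lambda>(j, k). real j powr (- (3 * a / 2)) * real k powr (- (3 * a / 2)))"
proof -
  have "summable (\<lambda>n. real n powr (- (3 * a / 2)))"
    using assms by (subst summable_real_powr_iff) auto
  hence "integrable (count_space {1..}) (\<lambda>n. real n powr (- (3 * a / 2)))"
    by (intro integrable_count_space_atLeast_1) simp
  thus ?thesis by (intro integral_count_space_product)
qed

lemma integrable_omega_term:
  assumes "Re s > 2 / 3"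
  shows "integrable (count_space pair_indices) (omega_term s)"
proof (rule Bochner_Integration.integrable_bound[OF integrable_pair_bound[OF assms]])
  show "AE p in count_space pair_indices. norm (omega_term s p) \<le>
      norm (case p of (j, k) \<Rightarrow> real j powr (- (3 * Re s / 2)) * real k powr (- (3 * Re s / 2)))"
    using assms by (intro AE_I2) (auto intro!: norm_omega_term_le)
qed auto

lemma abs_summable_on_omega_term:
  assumes "Re s > 2 / 3"
  shows "Infinite_Set_Sum.abs_summable_on (omega_term s) pair_indices"
  unfolding Infinite_Set_Sum.abs_summable_on_def by (rule integrable_omega_term[OF assms])

lemma summable_on_omega_term:
  assumes "Re s > 2 / 3"
  shows "omega_term s summable_on pair_indices"
  using abs_summable_on_omega_term[OF assms]
  by (rule abs_summable_summable[OF abs_summable_equivalent[THEN iffD2]])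

lemma omega_series_eq_integral:
  "Re s > 2 / 3 \<Longrightarrow> omega_series s = (\<integral>p. omega_term s p \<partial>count_space pair_indices)"
  unfolding omega_series_def infsetsum_def[symmetric] pair_indices_def[symmetric]
  by (rule infsetsum_infsum[OF abs_summable_on_omega_term, symmetric])

lemma holomorphic_omega_series: "omega_series holomorphic_on {s. Re s > 2 / 3}"
proof -
  have "(\<lambda>s. \<integral>p. omega_term s p \<partial>count_space pair_indices) holomorphic_on {s. Re s > 2 / 3}"
  proof (rule holomorphic_on_lebesgue_integral)
    show "open {s. Re s > 2 / 3}" by (rule open_halfspace_Re_gt)
    show "(\<lambda>s. omega_term s p) holomorphic_on {s. Re s > 2 / 3}" for p
      by (cases p) (auto simp: omega_term_def intro!: holomorphic_intros)
    fix s assume s: "s \<in> {s. Re s > 2 / 3}"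
    define a where "a = (Re s + 2 / 3) / 2"
    have a: "a > 2 / 3" "a < Re s" using s by (auto simp: a_def)
    show "\<exists>r>0. \<exists>g. integrable (count_space pair_indices) g \<and> (\<forall>t\<in>{s. Re s > 2 / 3}. dist t s < r \<longrightarrow>
        (\<forall>p\<in>space (count_space pair_indices). norm (omega_term t p) \<le> g p))"
    proof (intro exI[of _ "Re s - a"] conjI exI ballI impI)
      show "integrable (count_space pair_indices) (\<lambda>(j, k). real j powr (- (3 * a / 2)) * real k powr (- (3 * a / 2)))"
        by (rule integrable_pair_bound[OF a(1)])
      fix t p assume t: "dist t s < Re s - a" and p: "p \<in> space (count_space pair_indices)"
      have "Re t \<ge> a" using t abs_Re_le_cmod[of "t - s"] by (simp add: dist_norm)
      thus "norm (omega_term t p) \<le> (case p of (j, k) \<Rightarrow> real j powr (- (3 * a / 2)) * real k powr (- (3 * a / 2)))"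
        using p a by (cases p) (auto intro!: norm_omega_term_le)
    qed (use a in auto)
  qed auto
  thus ?thesis
    by (rule holomorphic_transform) (auto simp: omega_series_eq_integral)
qed

lemma polylog_exp_squared:
  assumes "x > 0"
  shows "(\<integral>p. (case p of (j, k) \<Rightarrow> rpow (real j) (- s) * rpow (real k) (- s)) *
      of_real (exp (- (case p of (j, k) \<Rightarrow> real (j + k)) * x)) \<partial>count_space pair_indices) =
    (polylog_exp s (of_real x)) ^ 2"
proof -
  have int: "integrable (count_space {1..}) (\<lambda>k. rpow (real k) (- s) * exp (- of_nat k * of_real x))"
    using assms by (intro integrable_polylog_term) simp
  have "(\<integral>p. (case p of (j, k) \<Rightarrow> rpow (real j) (- s) * rpow (real k) (- s)) *
      of_real (exp (- (case p of (j, k) \<Rightarrow> real (j + k)) * x)) \<partial>count_space pair_indices) =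
    (\<integral>(j, k). (rpow (real j) (- s) * exp (- of_nat j * of_real x)) *
      (rpow (real k) (- s) * exp (- of_nat k * of_real x)) \<partial>count_space pair_indices)"
    by (intro Bochner_Integration.integral_cong refl)
       (auto simp: ring_distribs exp_add exp_diff exp_minus divide_inverse mult_ac simp flip: exp_of_real)
  thus ?thesis
    using integral_count_space_product(2)[OF int int] by (simp add: polylog_exp_def power2_eq_square)
qed

text \<open>Only the factor \<open>(j + k) powr (- s)\<close> is expressed through exponentials; the
  weight \<open>j powr (- s) * k powr (- s)\<close> stays in the coefficients. Since
  \<open>exp (- (j + k) x)\<close> factorizes, the double sum becomes a square.\<close>

lemma omega_Mellin:
  assumes s: "Re s > 2 / 3"
  shows "integrable half_line (\<lambda>x. rpow x (s - 1) * (polylog_exp s (of_real x)) ^ 2)"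
    and "(\<integral>x. rpow x (s - 1) * (polylog_exp s (of_real x)) ^ 2 \<partial>half_line) = Gamma s * omega_series s"
proof -
  define l :: "nat \<times> nat \<Rightarrow> real" where "l = (\<lambda>(j, k). real (j + k))"
  define a :: "nat \<times> nat \<Rightarrow> complex" where "a = (\<lambda>(j, k). rpow (real j) (- s) * rpow (real k) (- s))"
  have s0: "Re s > 0" using s by simp
  have l: "l p > 0" if "p \<in> space (count_space pair_indices)" for p
    using that by (cases p) (auto simp: l_def)
  have term_eq: "a p * rpow (l p) (- s) = omega_term s p" if "p \<in> space (count_space pair_indices)" for p
    using that by (cases p) (auto simp: a_def l_def omega_term_eq_rpow)
  have int: "integrable (count_space pair_indices) (\<lambda>p. norm (a p) * l p powr (- Re s))"
  proof (rule Bochner_Integration.integrable_cong[THEN iffD1, OF refl])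
    show "integrable (count_space pair_indices) (\<lambda>p. norm (omega_term s p))"
      by (intro integrable_norm integrable_omega_term s)
    show "norm (omega_term s p) = norm (a p) * l p powr (- Re s)" if "p \<in> space (count_space pair_indices)" for p
      using l[OF that] unfolding term_eq[OF that, symmetric] by (simp add: norm_mult norm_rpow)
  qed
  have inner: "(\<integral>p. a p * of_real (exp (- l p * x)) \<partial>count_space pair_indices) = (polylog_exp s (of_real x)) ^ 2"
    if "x \<in> space half_line" for x
    unfolding a_def l_def using that by (subst polylog_exp_squared) auto
  have inner': "rpow x (s - 1) * (\<integral>p. a p * of_real (exp (- l p * x)) \<partial>count_space pair_indices) =
      rpow x (s - 1) * (polylog_exp s (of_real x)) ^ 2" if "x \<in> space half_line" for x
    unfolding inner[OF that] ..
  have outer: "(\<integral>p. a p * rpow (l p) (- s) \<partial>count_space pair_indices) = omega_series s"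
    unfolding omega_series_eq_integral[OF s]
    by (intro Bochner_Integration.integral_cong refl term_eq)
  note M = Mellin_exponential_integral[OF sigma_finite_pair_indices _ _ l s0 int]
  have "integrable half_line (\<lambda>x. rpow x (s - 1) * (\<integral>p. a p * of_real (exp (- l p * x)) \<partial>count_space pair_indices))"
    by (rule M) auto
  thus "integrable half_line (\<lambda>x. rpow x (s - 1) * (polylog_exp s (of_real x)) ^ 2)"
    by (subst (asm) Bochner_Integration.integrable_cong[OF refl inner'])
  have "(\<integral>x. rpow x (s - 1) * (\<integral>p. a p * of_real (exp (- l p * x)) \<partial>count_space pair_indices) \<partial>half_line) =
      Gamma s * omega_series s"
    unfolding outer[symmetric] by (rule M) auto
  thus "(\<integral>x. rpow x (s - 1) * (polylog_exp s (of_real x)) ^ 2 \<partial>half_line) = Gamma s * omega_series s"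
    by (subst (asm) Bochner_Integration.integral_cong[OF refl inner'])
qed

section \<open>The entire contribution of the interval \<open>(1, \<infinity>)\<close>\<close>

definition omega_tail :: "complex \<Rightarrow> complex" where
  "omega_tail s = (\<integral>x. rpow x (s - 1) * (polylog_exp s (of_real x)) ^ 2 \<partial>restrict_space lborel {1<..})"

lemma continuous_on_polylog_exp: "continuous_on {0<..} (\<lambda>x. polylog_exp s (of_real x))"
proof (rule continuous_on_compose2[of "{z. Re z > 0}" "polylog_exp s"])
  show "continuous_on {z. Re z > 0} (polylog_exp s)"
    by (intro continuous_at_imp_continuous_on ballI DERIV_isCont[OF has_field_derivative_polylog_exp]) auto
qed (auto intro!: continuous_intros)

lemma holomorphic_omega_tail: "omega_tail holomorphic_on UNIV"
  unfolding omega_tail_def[abs_def]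
proof (rule holomorphic_on_lebesgue_integral)
  let ?M = "restrict_space lborel {1<..} :: real measure"
  have space: "space ?M = {1<..}" by (simp add: space_restrict_space)
  show "(\<lambda>s. rpow x (s - 1) * (polylog_exp s (of_real x)) ^ 2) holomorphic_on UNIV" if "x \<in> space ?M" for x
    using that unfolding space by (intro holomorphic_intros holomorphic_polylog_exp) auto
  show "(\<lambda>x. rpow x (s - 1) * (polylog_exp s (of_real x)) ^ 2) \<in> borel_measurable ?M" for s
  proof -
    have "continuous_on {1<..} (\<lambda>x. rpow x (s - 1) * (polylog_exp s (of_real x)) ^ 2)"
      by (intro continuous_intros continuous_on_subset[OF continuous_on_polylog_exp]) auto
    from borel_measurable_continuous_on_restrict[OF this] show ?thesis
      by (subst measurable_cong_sets[OF _ refl, of _ "restrict_space borel {1<..}"])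
         (simp_all add: sets_restrict_space)
  qed
  fix s :: complex
  \<comment> \<open>Bounds for all \<open>t\<close> with \<open>dist t s < 1\<close>:
    \<open>Re t - 1 \<le> b\<close> controls the power of \<open>x\<close>, and
    \<open>Re t \<ge> - (1 - Re s)\<close> makes \<open>I\<close> a common constant for the
    polylogarithms.\<close>
  define b where "b = \<bar>Re s\<bar>"
  define I where "I = (\<integral>k. real k powr (1 - Re s) * exp (- (real k * (1 / 2))) \<partial>count_space {1..})"
  have "integrable half_line (\<lambda>x. norm (rpow x (of_real (b + 1) - 1) * of_real (exp (- 1 * x))))"
    by (intro integrable_norm half_line_Gamma_integral) (auto simp: b_def)
  also have "?this \<longleftrightarrow> integrable half_line (\<lambda>x. x powr b * exp (- x))"
    by (intro Bochner_Integration.integrable_cong refl) (auto simp: norm_mult norm_rpow)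
  finally have "set_integrable lborel {1<..} (\<lambda>x. x powr b * exp (- x))"
    unfolding integrable_half_line by (rule set_integrable_subset) auto
  hence int: "integrable ?M (\<lambda>x. x powr b * exp (- x))"
    by (subst integrable_restrict_space) (auto simp: set_integrable_def)
  show "\<exists>r>0. \<exists>g. integrable ?M g \<and> (\<forall>t\<in>UNIV. dist t s < r \<longrightarrow>
      (\<forall>x\<in>space ?M. norm (rpow x (t - 1) * (polylog_exp t (of_real x)) ^ 2) \<le> g x))"
  proof (intro exI[of _ 1] conjI exI[of _ "\<lambda>x. (x powr b * exp (- x)) * I ^ 2"] ballI impI)
    show "integrable ?M (\<lambda>x. (x powr b * exp (- x)) * I ^ 2)"
      using int by (rule integrable_mult_left)
    fix t x assume t: "dist t s < 1" and "x \<in> space ?M"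
    hence x: "x > 1" unfolding space by simp
    have Re: "\<bar>Re t - Re s\<bar> < 1" using t abs_Re_le_cmod[of "t - s"] by (simp add: dist_norm)
    have "norm (polylog_exp t (of_real x)) \<le> I * exp (- (x / 2))"
      unfolding I_def using x Re by (intro norm_polylog_exp_le) auto
    hence "norm (polylog_exp t (of_real x)) ^ 2 \<le> (I * exp (- (x / 2))) ^ 2"
      by (intro power_mono) auto
    also have "\<dots> = I ^ 2 * exp (- x)"
      by (simp add: power_mult_distrib flip: exp_of_nat_mult)
    finally have 1: "norm (polylog_exp t (of_real x)) ^ 2 \<le> I ^ 2 * exp (- x)" .
    have "x powr (Re t - 1) \<le> x powr b"
      using x Re by (intro powr_mono) (auto simp: b_def)
    with 1 have "x powr (Re t - 1) * norm (polylog_exp t (of_real x)) ^ 2 \<le> x powr b * (I ^ 2 * exp (- x))"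
      by (intro mult_mono) auto
    thus "norm (rpow x (t - 1) * (polylog_exp t (of_real x)) ^ 2) \<le> (x powr b * exp (- x)) * I ^ 2"
      using x by (simp add: norm_mult norm_rpow norm_power mult_ac)
  qed auto
qed auto

lemma integral_half_line_split:
  fixes f :: "real \<Rightarrow> complex"
  assumes "integrable half_line f"
  shows "integral\<^sup>L half_line f = integral\<^sup>L unit_interval f + integral\<^sup>L (restrict_space lborel {1<..}) f"
proof -
  have 1: "set_integrable lborel {0<..1} f" "set_integrable lborel {1<..} f"
    using assms unfolding integrable_half_line by (auto elim!: set_integrable_subset)
  have "{0<..} = {0<..1} \<union> {1::real<..}" by auto
  hence "integral\<^sup>L half_line f = (LINT x:{0<..1} \<union> {1<..}|lborel. f x)"
    by (simp add: integral_half_line)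
  also have "\<dots> = (LINT x:{0<..1}|lborel. f x) + (LINT x:{1<..}|lborel. f x)"
    using 1 by (intro set_integral_Un) auto
  also have "(LINT x:{1<..}|lborel. f x) = integral\<^sup>L (restrict_space lborel {1<..}) f"
    unfolding set_lebesgue_integral_def by (rule integral_restrict_space[symmetric]) auto
  finally show ?thesis by (simp add: integral_unit_interval)
qed

text \<open>The constant \<open>1\<close> followed by zeros is a derivative chain, so one
  integration by parts evaluates the moment.\<close>

lemma unit_moment_1:
  assumes "Re w > 0"
  shows "unit_moment w (\<lambda>_. 1) = 1 / w"
proof -
  define h :: "nat \<Rightarrow> real \<Rightarrow> complex" where "h m = (\<lambda>_. if m = 0 then 1 else 0)" for m
  have "deriv_chain h" by (auto simp: deriv_chain_def h_def)
  from unit_moment_by_parts[OF this assms, of 0] have "w * unit_moment w (\<lambda>_. 1) = 1"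
    by (simp add: h_def unit_moment_def)
  moreover have "w \<noteq> 0" using assms by auto
  ultimately show ?thesis by (simp add: field_simps)
qed

abbreviation sq_chain :: "complex \<Rightarrow> nat \<Rightarrow> real \<Rightarrow> complex" where
  "sq_chain s \<equiv> prod_chain (reg_chain s) (reg_chain s)"

text \<open>With \<open>G = Gamma (1 - s)\<close>, squaring \<open>R + G * x powr (s - 1)\<close>
  gives moments at \<open>3 s - 2\<close>, \<open>2 s - 1\<close> and \<open>s\<close>. The first is
  the most singular at \<open>0\<close>; its convergence is the condition
  \<open>Re s > 2 / 3\<close>.\<close>

lemma omega_series_strip:
  assumes s: "2 / 3 < Re s" "Re s < 1"
  shows "omega_series s = rGamma s * (Gamma (1 - s) ^ 2 / (3 * s - 2) +
    2 * Gamma (1 - s) * unit_moment (2 * s - 1) (reg_chain s 0) + unit_moment s (sq_chain s 0) + omega_tail s)"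
proof -
  define G where "G = Gamma (1 - s)"
  have cont: "continuous_on {0<..1} (h m)" if "deriv_chain h" for h m
    by (rule continuous_on_subset[OF deriv_chainD(3)[OF that]]) auto
  note ch = deriv_chain_reg[OF s(2)] deriv_chain_prod[OF deriv_chain_reg[OF s(2)] deriv_chain_reg[OF s(2)]]
  obtain C where C: "\<And>x. 0 < x \<Longrightarrow> x \<le> 1 \<Longrightarrow> norm (reg_chain s 0 x) \<le> C"
    using deriv_chainD(2)[OF ch(1)] by blast
  obtain C' where C': "\<And>x. 0 < x \<Longrightarrow> x \<le> 1 \<Longrightarrow> norm (sq_chain s 0 x) \<le> C'"
    using deriv_chainD(2)[OF ch(2)] by blast
  have I1: "integrable unit_interval (\<lambda>x. rpow x (3 * s - 2 - 1) * 1)"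
    using s by (intro integrable_unit_moment[of _ _ 1]) auto
  have I2: "integrable unit_interval (\<lambda>x. rpow x (2 * s - 1 - 1) * reg_chain s 0 x)"
    using s by (intro integrable_unit_moment[OF _ cont[OF ch(1)] C]) auto
  have I3: "integrable unit_interval (\<lambda>x. rpow x (s - 1) * sq_chain s 0 x)"
    using s by (intro integrable_unit_moment[OF _ cont[OF ch(2)] C']) auto
  have eq: "rpow x (s - 1) * (polylog_exp s (of_real x)) ^ 2 =
      G ^ 2 * (rpow x (3 * s - 2 - 1) * 1) + 2 * G * (rpow x (2 * s - 1 - 1) * reg_chain s 0 x) +
      rpow x (s - 1) * sq_chain s 0 x" for x
  proof -
    define q where "q = rpow x (s - 1)"
    have "rpow x (2 * s - 1 - 1) = q * q" "rpow x (3 * s - 2 - 1) = q * q * q"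
      unfolding q_def rpow_add[symmetric] by (simp_all add: algebra_simps)
    moreover have "polylog_exp s (of_real x) = polylog_reg s x + G * q"
      by (simp add: polylog_reg_def G_def q_def)
    ultimately show ?thesis
      by (simp add: q_def[symmetric] reg_chain_def prod_chain_def power2_eq_square algebra_simps)
  qed
  have "(\<integral>x. rpow x (s - 1) * (polylog_exp s (of_real x)) ^ 2 \<partial>unit_interval) =
      G ^ 2 * unit_moment (3 * s - 2) (\<lambda>_. 1) + 2 * G * unit_moment (2 * s - 1) (reg_chain s 0) +
      unit_moment s (sq_chain s 0)"
    unfolding eq unit_moment_def
    by (simp only: Bochner_Integration.integral_add integrable_mult_right Bochner_Integration.integrable_add
        I1 I2 I3 integral_mult_right_zero)
  moreover have "unit_moment (3 * s - 2) (\<lambda>_. 1) = 1 / (3 * s - 2)"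
    using s by (intro unit_moment_1) simp
  ultimately have "Gamma s * omega_series s = G ^ 2 / (3 * s - 2) +
      2 * G * unit_moment (2 * s - 1) (reg_chain s 0) + unit_moment s (sq_chain s 0) + omega_tail s"
    using omega_Mellin[OF s(1)] by (simp add: integral_half_line_split omega_tail_def)
  moreover have "s \<notin> \<int>\<^sub>\<le>\<^sub>0" using s by (intro not_nonpos_Int_if_Re_pos) simp
  hence "rGamma s * Gamma s = 1" by (simp add: rGamma_inverse_Gamma Gamma_eq_zero_iff)
  hence "omega_series s = rGamma s * (Gamma s * omega_series s)" by (simp flip: mult.assoc)
  ultimately show ?thesis by (simp add: G_def)
qed

section \<open>Clearing the poles: an entire numerator\<close>

text \<open>The factor \<open>2 powr (2 s - 2) / sqrt pi\<close> of the Legendre duplication formula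
  taken at \<open>s - 1 / 2\<close>.\<close>

definition dupl_factor :: "complex \<Rightarrow> complex" where
  "dupl_factor s = exp ((2 * s - 2) * of_real (ln 2)) / of_real (sqrt pi)"

lemma rGamma_duplication:
  assumes "Re s > 1 / 2"
  shows "rGamma (s - 1 / 2) * rGamma s = dupl_factor s * rGamma (2 * s - 1)"
proof -
  have "s - 1 / 2 \<notin> \<int>\<^sub>\<le>\<^sub>0" "s - 1 / 2 + 1 / 2 \<notin> \<int>\<^sub>\<le>\<^sub>0"
    using assms by (intro not_nonpos_Int_if_Re_pos; simp)+
  from Gamma_legendre_duplication[OF this]
  have "Gamma (s - 1 / 2) * Gamma s = exp ((2 - 2 * s) * of_real (ln 2)) * of_real (sqrt pi) * Gamma (2 * s - 1)"
    by (simp add: algebra_simps)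
  hence "inverse (Gamma (s - 1 / 2) * Gamma s) =
      inverse (exp ((2 - 2 * s) * of_real (ln 2))) / of_real (sqrt pi) * inverse (Gamma (2 * s - 1))"
    by (simp add: field_simps)
  also have "inverse (exp ((2 - 2 * s) * of_real (ln 2))) = exp ((2 * s - 2) * of_real (ln 2))"
    by (simp add: exp_minus[symmetric] algebra_simps)
  finally show ?thesis by (simp add: rGamma_inverse_Gamma dupl_factor_def)
qed

text \<open>
  The factor \<open>3 s - 2\<close> cancels the pole at \<open>2/3\<close>; \<open>rGamma (s - 1 / 2)\<close> cancels the poles of \<open>\<Gamma>(2 s - 1) / \<Gamma>(s)\<close>, which
  equals \<open>dupl_factor s * \<Gamma>(s - 1 / 2)\<close> by the duplication formula.
\<close>

definition omega_numerator :: "nat \<Rightarrow> complex \<Rightarrow> complex" where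
  "omega_numerator M s =
     rGamma (s - 1 / 2) * (rGamma s * Gamma (1 - s) ^ 2 +
       (3 * s - 2) * (regularized_moment M s (sq_chain s) + rGamma s * omega_tail s)) +
     (3 * s - 2) * (2 * Gamma (1 - s) * dupl_factor s * regularized_moment (2 * M + 1) (2 * s - 1) (reg_chain s))"

lemma omega_numerator_eq:
  assumes s: "2 / 3 < Re s" "Re s < 1"
  shows "omega_numerator M s = (3 * s - 2) * rGamma (s - 1 / 2) * omega_series s"
proof -
  note ch = deriv_chain_reg[OF s(2)] deriv_chain_prod[OF deriv_chain_reg[OF s(2)] deriv_chain_reg[OF s(2)]]
  have K1: "regularized_moment M s (sq_chain s) = rGamma s * unit_moment s (sq_chain s 0)"
    using s by (intro regularized_moment_eq_0 ch) auto
  have "regularized_moment (2 * M + 1) (2 * s - 1) (reg_chain s) =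
      rGamma (2 * s - 1) * unit_moment (2 * s - 1) (reg_chain s 0)"
    using s by (intro regularized_moment_eq_0 ch) auto
  hence K2: "dupl_factor s * regularized_moment (2 * M + 1) (2 * s - 1) (reg_chain s) =
      rGamma (s - 1 / 2) * rGamma s * unit_moment (2 * s - 1) (reg_chain s 0)"
    using s by (simp add: rGamma_duplication)
  have "3 * s - 2 \<noteq> 0" using s by (auto simp: complex_eq_iff)
  define D where "D = Gamma (1 - s) ^ 2 / (3 * s - 2)"
  have div: "Gamma (1 - s) ^ 2 = (3 * s - 2) * D"
    using \<open>3 * s - 2 \<noteq> 0\<close> by (simp add: D_def)
  have "omega_numerator M s =
     rGamma (s - 1 / 2) * (rGamma s * Gamma (1 - s) ^ 2 +
       (3 * s - 2) * (rGamma s * unit_moment s (sq_chain s 0) + rGamma s * omega_tail s)) +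
     (3 * s - 2) * (2 * Gamma (1 - s) * (rGamma (s - 1 / 2) * rGamma s * unit_moment (2 * s - 1) (reg_chain s 0)))"
    unfolding omega_numerator_def K1 K2[symmetric] by (simp only: mult.assoc)
  also have "\<dots> = (3 * s - 2) * rGamma (s - 1 / 2) * omega_series s"
  proof -
    have "a * (r * (t * d) + t * (r * u + r * v)) + t * (2 * g * (a * r * w)) =
        t * a * (r * (d + 2 * g * w + u + v))" for a r t d u v g w :: complex
      by (simp add: ring_distribs mult_ac add_ac)
    note alg = this
    have ser: "omega_series s = rGamma s * (D + 2 * Gamma (1 - s) * unit_moment (2 * s - 1) (reg_chain s 0) +
        unit_moment s (sq_chain s 0) + omega_tail s)"
      unfolding D_def by (rule omega_series_strip[OF s])
    show ?thesis
      unfolding ser div by (rule alg)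
  qed
  finally show ?thesis .
qed

text \<open>The cross term lives at \<open>2 s - 1\<close>, and \<open>Re s > -M\<close> means
  \<open>Re (2 s - 1) > - (2 M + 1)\<close>. This explains the depth \<open>2 M + 1\<close> and the
  two integrations by parts for each step of \<open>M\<close>.\<close>

lemma omega_numerator_Suc:
  assumes "- real M < Re s" "Re s < 1"
  shows "omega_numerator (Suc M) s = omega_numerator M s"
proof -
  note ch = deriv_chain_reg[OF assms(2)] deriv_chain_prod[OF deriv_chain_reg[OF assms(2)] deriv_chain_reg[OF assms(2)]]
  have "regularized_moment (Suc M) s (sq_chain s) = regularized_moment M s (sq_chain s)"
    using assms by (intro regularized_moment_Suc ch) auto
  moreover have "regularized_moment (Suc (Suc (2 * M + 1))) (2 * s - 1) (reg_chain s) =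
      regularized_moment (2 * M + 1) (2 * s - 1) (reg_chain s)"
    using assms by (subst regularized_moment_Suc; (intro ch regularized_moment_Suc)?) auto
  moreover have "2 * Suc M + 1 = Suc (Suc (2 * M + 1))" by simp
  ultimately show ?thesis unfolding omega_numerator_def by simp
qed

lemma omega_numerator_mono:
  assumes "- real M < Re s" "Re s < 1" "M \<le> N"
  shows "omega_numerator N s = omega_numerator M s"
  using assms(3)
proof (induction N rule: dec_induct)
  case (step N)
  thus ?case using assms by (subst omega_numerator_Suc) auto
qed simp

lemma holomorphic_omega_numerator:
  "omega_numerator M holomorphic_on {s. - real M < Re s \<and> Re s < 1}" (is "_ holomorphic_on ?S")
proof -
  have S: "open ?S"
    using open_Int[OF open_halfspace_Re_gt[of "- real M"] open_halfspace_Re_lt[of 1]]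
    by (simp add: Int_def)
  have Sb: "?S \<subseteq> {s. Re s < 1}" by auto
  have reg: "(\<lambda>s. reg_chain s m x) holomorphic_on ?S" if "0 < x" for m x
    by (rule holomorphic_on_subset[OF holomorphic_reg_chain[OF that] Sb])
  have 1: "(\<lambda>s. regularized_moment M s (sq_chain s)) holomorphic_on ?S"
  proof (rule holomorphic_regularized_moment[OF S])
    show "(\<lambda>s. sq_chain s m x) holomorphic_on ?S" if "0 < x" for m x
      unfolding prod_chain_def by (intro holomorphic_intros reg that)
    show "deriv_chain (sq_chain s)" if "s \<in> ?S" for s
      using that by (intro deriv_chain_prod deriv_chain_reg) auto
    show "\<exists>r>0. \<exists>C. \<forall>t x. dist t s < r \<longrightarrow> 0 < x \<longrightarrow> x \<le> 1 \<longrightarrow> norm (sq_chain t m x) \<le> C"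
      if "s \<in> ?S" for s m
      using that by (intro prod_reg_chain_locally_bounded) auto
  qed (auto intro: holomorphic_on_ident)
  have 2: "(\<lambda>s. regularized_moment (2 * M + 1) (2 * s - 1) (reg_chain s)) holomorphic_on ?S"
  proof (rule holomorphic_regularized_moment[OF S])
    show "(\<lambda>s. 2 * s - 1) holomorphic_on ?S" by (intro holomorphic_intros)
    show "deriv_chain (reg_chain s)" if "s \<in> ?S" for s
      using that by (intro deriv_chain_reg) auto
    show "\<exists>r>0. \<exists>C. \<forall>t x. dist t s < r \<longrightarrow> 0 < x \<longrightarrow> x \<le> 1 \<longrightarrow> norm (reg_chain t m x) \<le> C"
      if "s \<in> ?S" for s m
      using that by (intro reg_chain_locally_bounded) auto
  qed (use reg in auto)
  have 3: "(\<lambda>s. Gamma (1 - s)) holomorphic_on ?S"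
    by (intro holomorphic_intros) (auto intro!: not_nonpos_Int_if_Re_pos)
  have 4: "omega_tail holomorphic_on ?S"
    by (rule holomorphic_on_subset[OF holomorphic_omega_tail]) auto
  show ?thesis
    unfolding omega_numerator_def[abs_def] dupl_factor_def
    by (intro holomorphic_intros 1 2 3 4) auto
qed

lemma omega_numerator_entire:
  obtains H where "H holomorphic_on UNIV"
    and "\<And>s. Re s > 2 / 3 \<Longrightarrow> H s = (3 * s - 2) * rGamma (s - 1 / 2) * omega_series s"
    and "\<And>M s. - real M < Re s \<Longrightarrow> Re s < 1 \<Longrightarrow> H s = omega_numerator M s"
proof -
  \<comment> \<open>The depth is chosen so that \<open>- M < Re s\<close>; any other admissible
    depth gives the same value. In the strip \<open>2/3 < Re s < 1\<close> the two branches agree by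
    \<open>omega_numerator_eq\<close>.\<close>
  define H where "H s = (if Re s > 2 / 3 then (3 * s - 2) * rGamma (s - 1 / 2) * omega_series s
    else omega_numerator (Suc (nat \<lceil>- Re s\<rceil>)) s)" for s
  have H1: "H s = (3 * s - 2) * rGamma (s - 1 / 2) * omega_series s" if "Re s > 2 / 3" for s
    using that by (simp add: H_def)
  have H2: "H s = omega_numerator M s" if s: "- real M < Re s" "Re s < 1" for M s
  proof (cases "Re s > 2 / 3")
    case True
    thus ?thesis using s by (simp add: H_def omega_numerator_eq)
  next
    case False
    define N where "N = Suc (nat \<lceil>- Re s\<rceil>)"
    have N: "- real N < Re s" unfolding N_def by linarith
    have "omega_numerator N s = omega_numerator M s"
      using omega_numerator_mono[OF s, of N] omega_numerator_mono[OF N s(2), of M] by (cases "M \<le> N") auto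
    thus ?thesis using False by (simp add: H_def N_def)
  qed
  have "H holomorphic_on {s. Re s > 2 / 3}"
  proof (rule holomorphic_transform)
    show "(\<lambda>s. (3 * s - 2) * rGamma (s - 1 / 2) * omega_series s) holomorphic_on {s. Re s > 2 / 3}"
      by (intro holomorphic_intros holomorphic_omega_series)
  qed (simp add: H1)
  moreover have "H holomorphic_on {s. - real M < Re s \<and> Re s < 1}" for M
    by (rule holomorphic_transform[OF holomorphic_omega_numerator]) (auto intro!: H2[symmetric])
  moreover have "open {s. - real M < Re s \<and> Re s < 1}" for M
    using open_Int[OF open_halfspace_Re_gt[of "- real M"] open_halfspace_Re_lt[of 1]]
    by (simp add: Int_def)
  ultimately have "H holomorphic_on (\<Union>M. {s. - real M < Re s \<and> Re s < 1}) \<union> {s. Re s > 2 / 3}"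
    by (intro holomorphic_on_Un holomorphic_on_UN_open open_UN open_halfspace_Re_gt ballI) auto
  moreover have "(\<Union>M. {s. - real M < Re s \<and> Re s < 1}) \<union> {s. Re s > 2 / 3} = UNIV"
  proof -
    have "s \<in> (\<Union>M. {s. - real M < Re s \<and> Re s < 1}) \<union> {s. Re s > 2 / 3}" for s
    proof -
      obtain M :: nat where "- Re s < real M" using reals_Archimedean2 by blast
      thus ?thesis by (cases "Re s > 2 / 3") (auto intro!: exI[of _ M])
    qed
    thus ?thesis by blast
  qed
  ultimately have "H holomorphic_on UNIV" by simp
  with H1 H2 that show ?thesis by blast
qed

section \<open>The Bernoulli number identity\<close>

definition bernoulli_fps :: "complex fps" where
  "bernoulli_fps = - exp_fps2 / exp_fps1"

text \<open>In terms of Bernoulli numbers with \<open>B_1 = - 1 / 2\<close> this is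
  \<open>B_(k + 1) / (k + 1)\<close>.\<close>

definition bernoulli_deriv :: "nat \<Rightarrow> complex" where
  "bernoulli_deriv k = (deriv ^^ k) bernoulli_fun 0"

lemma bernoulli_fps_nth: "fps_nth bernoulli_fps k = bernoulli_deriv k / fact k"
  using fps_nth_fps_expansion[OF bernoulli_fun_has_fps_expansion, of k]
  by (simp add: bernoulli_fps_def bernoulli_deriv_def)

lemma bernoulli_fps_mult: "bernoulli_fps * exp_fps1 = - exp_fps2"
  unfolding bernoulli_fps_def by (simp add: fps_divide_unit mult.assoc inverse_mult_eq_1)

lemma bernoulli_deriv_0: "bernoulli_deriv 0 = - 1 / 2"
  and bernoulli_deriv_1: "bernoulli_deriv 1 = 1 / 12"
proof -
  have E: "fps_nth exp_fps1 1 = 1 / 2" "fps_nth exp_fps2 0 = 1 / 2" "fps_nth exp_fps2 1 = 1 / 6"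
    by (simp_all add: exp_fps1_def exp_fps2_def fact_numeral eval_nat_numeral)
  have 0: "fps_nth bernoulli_fps 0 = - 1 / 2"
    using arg_cong[OF bernoulli_fps_mult, of "\<lambda>f. fps_nth f 0"] E by simp
  have "fps_nth bernoulli_fps 0 * fps_nth exp_fps1 1 + fps_nth bernoulli_fps 1 = - fps_nth exp_fps2 1"
    using arg_cong[OF bernoulli_fps_mult, of "\<lambda>f. fps_nth f 1"] by (simp add: fps_mult_nth_1)
  hence "fps_nth bernoulli_fps 1 = - (1 / 6) - (- 1 / 2) * (1 / 2)"
    unfolding E 0 eq_diff_eq by (simp add: add.commute)
  hence "fps_nth bernoulli_fps 1 = 1 / 12" by simp
  with 0 show "bernoulli_deriv 0 = - 1 / 2" "bernoulli_deriv 1 = 1 / 12"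
    by (simp_all add: bernoulli_fps_nth)
qed

text \<open>The reason is \<open>1 / (exp z - 1) + 1 / (exp (- z) - 1) = - 1\<close>: the poles
  cancel in the sum, so \<open>bernoulli_fps + 1 / 2\<close> is odd.\<close>

lemma bernoulli_deriv_even:
  assumes "even k" "k > 0"
  shows "bernoulli_deriv k = 0"
proof -
  define e :: "complex fps" where "e = fps_exp 1"
  define m :: "complex fps" where "m = fps_const (- 1) * fps_X"
  define B where "B = bernoulli_fps"
  have m0: "fps_nth m 0 = 0" by (simp add: m_def)
  have B: "fps_X * (e - 1) * B = fps_X - (e - 1)"
  proof -
    have "fps_X * (e - 1) * B = fps_X * fps_X * (B * exp_fps1)"
      by (simp add: e_def flip: exp_fps1_mult_X)
    also have "\<dots> = - (fps_X * (fps_X * exp_fps2))"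
      by (simp only: B_def bernoulli_fps_mult) (simp add: mult_ac)
    also have "\<dots> = fps_X - fps_X * exp_fps1"
      by (simp add: exp_fps2_mult_X algebra_simps)
    finally show ?thesis by (simp add: exp_fps1_mult_X e_def)
  qed
  have em: "e oo m = fps_exp (- 1)"
    by (simp add: e_def m_def fps_compose_linear fps_exp_def)
  have ee: "e * fps_exp (- 1) = 1"
    by (simp add: e_def flip: fps_exp_add_mult)
  have Xm: "fps_X oo m = - fps_X" using m0 by (simp add: m_def)
  have "(fps_X * (e - 1) * B) oo m = (fps_X - (e - 1)) oo m" by (simp only: B)
  hence "- fps_X * (fps_exp (- 1) - 1) * (B oo m) = - fps_X - (fps_exp (- 1) - 1)"
    using m0 by (simp add: fps_compose_mult_distrib fps_compose_sub_distrib Xm em)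
  \<comment> \<open>Multiplication by \<open>e\<close> replaces \<open>exp (- X) - 1\<close> by
    \<open>1 - e\<close>, so both equations share the factor \<open>X * (e - 1)\<close>, which can
    then be cancelled.\<close>
  hence "e * (- fps_X * (fps_exp (- 1) - 1) * (B oo m)) = e * (- fps_X - (fps_exp (- 1) - 1))"
    by simp
  moreover have "e * (- fps_X * (fps_exp (- 1) - 1) * (B oo m)) =
      - fps_X * (e * fps_exp (- 1) - e) * (B oo m)"
    by (simp add: algebra_simps)
  moreover have "e * (- fps_X - (fps_exp (- 1) - 1)) = - (e * fps_X) - (e * fps_exp (- 1) - e)"
    by (simp add: algebra_simps)
  ultimately have "- fps_X * (1 - e) * (B oo m) = - (e * fps_X) - (1 - e)"
    by (simp only: ee)
  moreover have "- fps_X * (1 - e) = fps_X * (e - 1)" by (simp add: algebra_simps)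
  ultimately have B': "fps_X * (e - 1) * (B oo m) = - (e * fps_X) - (1 - e)" by (simp only:)
  have "fps_X * (e - 1) * (B + (B oo m)) = fps_X * (e - 1) * (- 1)"
    unfolding distrib_left[of "fps_X * (e - 1)"] B B' by (simp add: algebra_simps)
  moreover have "e - 1 \<noteq> 0"
  proof
    assume "e - 1 = 0"
    from arg_cong[OF this, of "\<lambda>f. fps_nth f 1"] show False by (simp add: e_def)
  qed
  ultimately have "B + (B oo m) = - 1"
    by (subst (asm) mult_cancel_left) auto
  hence "fps_nth (B + (B oo m)) k = fps_nth (- 1) k" by simp
  hence "fps_nth B k = 0"
    using assms by (simp add: m_def fps_compose_linear)
  thus ?thesis by (simp add: B_def bernoulli_fps_nth)
qed

section \<open>Polynomials in \<open>1 / (exp X - 1)\<close> and their polar parts\<close>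

text \<open>The Laurent series of \<open>1 / (exp X - 1)\<close>.\<close>

definition exp_pole :: "complex fls" where
  "exp_pole = fls_X_inv + fps_to_fls bernoulli_fps"

lemma exp_pole_mult: "exp_pole * fps_to_fls (fps_exp 1 - 1) = 1"
proof -
  have "fps_to_fls (fps_exp 1 - 1 :: complex fps) = fls_X * fps_to_fls exp_fps1"
    unfolding exp_fps1_mult_X[symmetric] by (simp add: fls_times_fps_to_fls)
  moreover have "exp_pole * (fls_X * fps_to_fls exp_fps1) =
      (fls_X_inv * fls_X) * fps_to_fls exp_fps1 + fls_X * fps_to_fls (bernoulli_fps * exp_fps1)"
    by (simp add: exp_pole_def ring_distribs fls_times_fps_to_fls mult_ac)
  moreover have "fls_X * fps_to_fls (bernoulli_fps * exp_fps1) = fps_to_fls (- (fps_X * exp_fps2))"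
    by (simp add: bernoulli_fps_mult fls_times_fps_to_fls)
  moreover have "fps_to_fls (- (fps_X * exp_fps2)) = 1 - fps_to_fls exp_fps1"
    by (simp add: exp_fps2_mult_X)
  ultimately show ?thesis by (simp add: fls_X_inv_times_conv_shift fls_X_times_conv_shift)
qed

text \<open>Differentiate \<open>F * E = 1\<close>, where \<open>E = exp X - 1\<close> satisfies
  \<open>E' = E + 1\<close>, and multiply by \<open>F\<close>.\<close>

lemma exp_pole_deriv: "fls_deriv exp_pole = - exp_pole - exp_pole ^ 2"
proof -
  define F E where "F = exp_pole" and "E = fps_to_fls (fps_exp 1 - 1 :: complex fps)"
  have FE: "F * E = 1" unfolding F_def E_def by (rule exp_pole_mult)
  have "fls_deriv E = E + 1"
    by (simp add: E_def fls_deriv_fps_to_fls)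
  moreover have "fls_deriv (F * E) = 0" by (simp add: FE)
  ultimately have "fls_deriv F * E = - (F * E) - F"
    by (simp add: ring_distribs add_eq_0_iff)
  hence "fls_deriv F * E * F = (- 1 - F) * F" by (simp add: FE)
  moreover have "fls_deriv F * E * F = fls_deriv F * (F * E)" by (simp add: mult_ac)
  ultimately show ?thesis by (simp add: FE F_def[symmetric] ring_distribs power2_eq_square)
qed

text \<open>The polynomials in \<open>exp_pole\<close> with zero constant term. Leaving out nonzero
  constants makes the polar part alone decide, and the differential equation keeps the set closed
  under differentiation.\<close>

inductive_set exp_pole_ideal :: "complex fls set" where
  power: "exp_pole ^ Suc i \<in> exp_pole_ideal"
| add: "x \<in> exp_pole_ideal \<Longrightarrow> y \<in> exp_pole_ideal \<Longrightarrow> x + y \<in> exp_pole_ideal"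
| scale: "x \<in> exp_pole_ideal \<Longrightarrow> fls_const c * x \<in> exp_pole_ideal"

lemma exp_pole_ideal_diff:
  assumes "x \<in> exp_pole_ideal" "y \<in> exp_pole_ideal"
  shows "x - y \<in> exp_pole_ideal"
  using exp_pole_ideal.add[OF assms(1) exp_pole_ideal.scale[OF assms(2), of "- 1"]] by simp

lemma exp_pole_ideal_sum:
  assumes "\<And>i. i \<in> A \<Longrightarrow> f i \<in> exp_pole_ideal"
  shows "sum f A \<in> exp_pole_ideal"
  using assms
proof (induction A rule: infinite_finite_induct)
  case (insert a A)
  thus ?case by (simp add: exp_pole_ideal.add)
qed (use exp_pole_ideal.scale[OF exp_pole_ideal.power, of 0] in simp_all)

lemma exp_pole_ideal_mult:
  assumes "x \<in> exp_pole_ideal" "y \<in> exp_pole_ideal"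
  shows "x * y \<in> exp_pole_ideal"
  using assms(1)
proof induction
  case (power i)
  show ?case using assms(2)
  proof induction
    case (power j)
    have "exp_pole ^ Suc i * exp_pole ^ Suc j = exp_pole ^ Suc (Suc (i + j))"
      by (simp add: power_add mult_ac)
    thus ?case by (simp only: exp_pole_ideal.power)
  next
    case (scale x c)
    thus ?case using exp_pole_ideal.scale[of "exp_pole ^ Suc i * x" c] by (simp only: mult_ac)
  qed (simp only: distrib_left exp_pole_ideal.add)
qed (simp_all only: distrib_right exp_pole_ideal.add mult.assoc exp_pole_ideal.scale)

lemma exp_pole_ideal_deriv:
  assumes "x \<in> exp_pole_ideal"
  shows "fls_deriv x \<in> exp_pole_ideal"
  using assms
proof induction
  case (power i)
  have "fls_deriv (exp_pole ^ Suc i) = fls_const (of_nat (Suc i)) * (exp_pole ^ i * fls_deriv exp_pole)"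
    by (subst fls_deriv_power) (simp add: fls_of_nat mult_ac)
  also have "exp_pole ^ i * fls_deriv exp_pole = fls_const (- 1) * (exp_pole ^ Suc i + exp_pole ^ Suc (Suc i))"
    by (simp add: exp_pole_deriv algebra_simps power2_eq_square)
  finally show ?case
    by (simp only: exp_pole_ideal.intros)
qed (simp_all add: exp_pole_ideal.intros)

lemma exp_pole_ideal_deriv_iter: "(fls_deriv ^^ n) exp_pole \<in> exp_pole_ideal"
  by (induction n) (use exp_pole_ideal.power[of 0] in \<open>auto intro: exp_pole_ideal_deriv\<close>)

lemma exp_pole_nth: "fls_nth exp_pole j = (if j = - 1 then 1 else if j < 0 then 0 else fps_nth bernoulli_fps (nat j))"
  by (auto simp: exp_pole_def)

lemma exp_pole_power_nth_below: "j < - int i \<Longrightarrow> fls_nth (exp_pole ^ i) j = 0"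
  and exp_pole_power_base: "fls_nth (exp_pole ^ i) (- int i) = 1"
proof -
  have 1: "fls_subdegree exp_pole = - 1"
    by (rule fls_subdegree_eqI) (auto simp: exp_pole_nth)
  show "j < - int i \<Longrightarrow> fls_nth (exp_pole ^ i) j = 0"
    by (rule fls_pow_nth_below_subdegree) (simp add: 1)
  show "fls_nth (exp_pole ^ i) (- int i) = 1"
    using fls_pow_base[of exp_pole i] unfolding 1 by (simp add: exp_pole_nth)
qed

text \<open>
  A polynomial in \<open>1 / (exp X - 1)\<close> is determined by its polar part and its constant term, because
  this series has a simple pole.
\<close>

lemma exp_pole_ideal_eq_0:
  assumes "x \<in> exp_pole_ideal" "\<And>j. j < 0 \<Longrightarrow> fls_nth x j = 0"
  shows "x = 0"
proof -
  have "\<exists>m c. x = (\<Sum>i<m. fls_const (c i) * exp_pole ^ Suc i)"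
    using assms(1)
  proof induction
    case (power i)
    have "(\<Sum>j<Suc i. fls_const (if j = i then 1 else 0) * exp_pole ^ Suc j) = exp_pole ^ Suc i"
      by (subst sum.remove[of _ i]) (auto intro!: sum.neutral)
    thus ?case by metis
  next
    case (add x y)
    then obtain m c n d where x: "x = (\<Sum>i<m. fls_const (c i) * exp_pole ^ Suc i)"
      and y: "y = (\<Sum>i<n. fls_const (d i) * exp_pole ^ Suc i)" by blast
    define N where "N = max m n"
    have x': "x = (\<Sum>i<N. fls_const (if i < m then c i else 0) * exp_pole ^ Suc i)"
      unfolding x by (intro sum.mono_neutral_cong_left) (auto simp: N_def)
    have y': "y = (\<Sum>i<N. fls_const (if i < n then d i else 0) * exp_pole ^ Suc i)"
      unfolding y by (intro sum.mono_neutral_cong_left) (auto simp: N_def)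
    have "x + y = (\<Sum>i<N. fls_const ((if i < m then c i else 0) + (if i < n then d i else 0)) * exp_pole ^ Suc i)"
      unfolding x' y' sum.distrib[symmetric] by (intro sum.cong refl) (simp only: fls_plus_const[symmetric] distrib_right)
    thus ?case by metis
  next
    case (scale x a)
    then obtain m c where x: "x = (\<Sum>i<m. fls_const (c i) * exp_pole ^ Suc i)" by blast
    have "fls_const a * x = (\<Sum>i<m. fls_const (a * c i) * exp_pole ^ Suc i)"
      unfolding x sum_distrib_left by (intro sum.cong refl) (simp add: mult.assoc flip: fls_const_mult_const)
    thus ?case by metis
  qed
  then obtain m c where x: "x = (\<Sum>i<m. fls_const (c i) * exp_pole ^ Suc i)" by blast
  have "c i = 0" if "i < m" for i
  proof (rule ccontr)
    assume "c i \<noteq> 0"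
    define S where "S = {i. i < m \<and> c i \<noteq> 0}"
    have S: "finite S" "S \<noteq> {}" using that \<open>c i \<noteq> 0\<close> by (auto simp: S_def)
    \<comment> \<open>The highest power that occurs: it alone contributes to the coefficient of
      \<open>X\<close> to the power \<open>- (k + 1)\<close>, and it contributes
      \<open>c k\<close>.\<close>
    define k where "k = Max S"
    have k: "k \<in> S" "\<And>i. i \<in> S \<Longrightarrow> i \<le> k" using S by (simp_all add: k_def)
    have "fls_nth x (- int (Suc k)) = (\<Sum>i<m. c i * fls_nth (exp_pole ^ Suc i) (- int (Suc k)))"
      unfolding x fls_nth_sum by (intro sum.cong refl fls_mult_const_nth)
    also have "\<dots> = (\<Sum>i\<in>{k}. c i * fls_nth (exp_pole ^ Suc i) (- int (Suc k)))"
    proof (intro sum.mono_neutral_right ballI)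
      fix i assume i: "i \<in> {..<m} - {k}"
      show "c i * fls_nth (exp_pole ^ Suc i) (- int (Suc k)) = 0"
      proof (cases "c i = 0")
        case False
        hence "i < k" using i k(2)[of i] by (auto simp: S_def)
        hence "fls_nth (exp_pole ^ Suc i) (- int (Suc k)) = 0" by (intro exp_pole_power_nth_below) simp
        thus ?thesis by simp
      qed simp
    qed (use k(1) in \<open>auto simp: S_def\<close>)
    also have "\<dots> = c k" using exp_pole_power_base[of "Suc k"] by simp
    finally show False using assms(2)[of "- int (Suc k)"] k(1) by (simp add: S_def)
  qed
  thus ?thesis unfolding x by (intro sum.neutral) auto
qed

text \<open>The Taylor series at \<open>0\<close> of the \<open>n\<close>-th derivative of
  \<open>bernoulli_fun\<close>, which is the regular part of the \<open>n\<close>-th derivative of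
  \<open>exp_pole\<close>.\<close>

definition bernoulli_tail :: "nat \<Rightarrow> complex fps" where
  "bernoulli_tail n = Abs_fps (\<lambda>j. bernoulli_deriv (n + j) / fact j)"

lemma bernoulli_tail_nth [simp]: "fps_nth (bernoulli_tail n) j = bernoulli_deriv (n + j) / fact j"
  by (simp add: bernoulli_tail_def)

lemma exp_pole_deriv_iter:
  "(fls_deriv ^^ n) exp_pole =
     fls_shift (int n + 1) (fls_const ((- 1) ^ n * fact n)) + fps_to_fls (bernoulli_tail n)"
proof (induction n)
  case 0
  show ?case
    by (rule fls_eqI) (auto simp: exp_pole_nth bernoulli_fps_nth)
next
  case (Suc n)
  have "fls_deriv (fls_shift (int n + 1) (fls_const ((- 1) ^ n * fact n)) + fps_to_fls (bernoulli_tail n)) =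
      fls_shift (int (Suc n) + 1) (fls_const ((- 1) ^ Suc n * fact (Suc n))) + fps_to_fls (bernoulli_tail (Suc n))"
  proof (rule fls_eqI)
    fix j :: int
    \<comment> \<open>The exponent \<open>- 1\<close> is singled out because there the constant
      coefficient of the tail is multiplied by \<open>j + 1 = 0\<close>.\<close>
    consider "j = - int n - 2" | "j = - 1" | "j \<noteq> - int n - 2" "j < - 1" | "j \<ge> 0" by linarith
    thus "fls_nth (fls_deriv (fls_shift (int n + 1) (fls_const ((- 1) ^ n * fact n)) + fps_to_fls (bernoulli_tail n))) j =
      fls_nth (fls_shift (int (Suc n) + 1) (fls_const ((- 1) ^ Suc n * fact (Suc n))) + fps_to_fls (bernoulli_tail (Suc n))) j"
    proof cases
      case 1
      show ?thesis unfolding 1 by (simp add: algebra_simps)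
    next
      case 4
      then obtain k where k: "j = int k" using nonneg_int_cases by blast
      have "fact (Suc k) = (of_nat (Suc k) * fact k :: complex)" by simp
      hence "of_nat (Suc k) * (bernoulli_deriv (n + Suc k) / fact (Suc k)) = bernoulli_deriv (Suc n + k) / fact k"
        by (simp del: fact_Suc of_nat_Suc)
      thus ?thesis by (simp add: k nat_add_distrib add.commute del: fact_Suc)
    qed (auto simp: algebra_simps)
  qed
  with Suc show ?case by simp
qed

lemma exp_pole_deriv_iter_nth_neg:
  "fls_nth ((fls_deriv ^^ n) exp_pole) (- int i - 1) = (if i = n then (- 1) ^ n * fact n else 0)"
  unfolding exp_pole_deriv_iter by auto

lemma exp_pole_deriv_iter_nth_nonneg:
  "fls_nth ((fls_deriv ^^ n) exp_pole) (int k) = bernoulli_deriv (n + k) / fact k"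
  unfolding exp_pole_deriv_iter by auto

lemma exp_pole_deriv_iter_squared_nth:
  "fls_nth (((fls_deriv ^^ n) exp_pole) ^ 2) k =
     (if k = - 2 * int n - 2 then (fact n) ^ 2 else 0) +
     2 * (- 1) ^ n * fact n * fls_nth (fps_to_fls (bernoulli_tail n)) (k + int n + 1) +
     fls_nth (fps_to_fls (bernoulli_tail n ^ 2)) k"
proof -
  define c :: complex where "c = (- 1) ^ n * fact n"
  define P where "P = fps_to_fls (bernoulli_tail n)"
  define A where "A = fls_shift (int n + 1) (fls_const c)"
  have "A * A = fls_shift (2 * int n + 2) (fls_const (c ^ 2))"
    by (simp add: A_def fls_times_both_shifted_simp power2_eq_square)
  moreover have "A * P = fls_shift (int n + 1) (fls_const c * P)"
    unfolding A_def by (rule fls_shifted_times_simps)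
  moreover have "((fls_deriv ^^ n) exp_pole) ^ 2 = A * A + 2 * (A * P) + P ^ 2"
    unfolding exp_pole_deriv_iter A_def P_def c_def by (simp add: power2_eq_square algebra_simps)
  ultimately have "((fls_deriv ^^ n) exp_pole) ^ 2 = fls_shift (2 * int n + 2) (fls_const (c ^ 2)) +
      2 * fls_shift (int n + 1) (fls_const c * P) + P ^ 2"
    by simp
  moreover have "c ^ 2 = (fact n) ^ 2"
    by (simp add: c_def power_mult_distrib flip: power_mult)
  ultimately show ?thesis
    by (auto simp: c_def P_def fps_to_fls_power algebra_simps)
qed

text \<open>The square of the \<open>n\<close>-th derivative of \<open>exp_pole\<close> lies in
  \<open>exp_pole_ideal\<close>, hence equals any combination of derivatives with the same polar
  part. The identity is \<open>n!\<close> times the coefficient of \<open>X ^ n\<close> in this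
  equality.\<close>

lemma bernoulli_deriv_identity:
  fixes n :: nat
  defines "p \<equiv> bernoulli_deriv"
  assumes "even n"
  shows "2 * (fact n ^ 2 / fact (2 * n + 1) * p (3 * n + 1)) + (\<Sum>i\<le>n. of_nat (n choose i) * (p (n + i) * p (2 * n - i))) =
    - (fact n ^ 2 / fact (2 * n + 1) * p (3 * n + 1)) +
    2 * (\<Sum>i\<le>n. (- 1) ^ i * (of_nat (n choose i) * (p (n + i) * p (2 * n - i))))"
proof -
  define D where "D i = (fls_deriv ^^ i) exp_pole" for i
  \<comment> \<open>For \<open>i \<le> n\<close>, \<open>q i\<close> is the coefficient of
    \<open>X\<close> to the power \<open>- i - 1\<close> in \<open>D n ^ 2\<close>, divided by the
    coefficient \<open>(- 1) ^ i * i!\<close> of \<open>D i\<close>. Likewise \<open>r\<close>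
    cancels the lowest term: \<open>D (2 n + 1)\<close> starts with \<open>- (2 n + 1)!\<close>,
    hence the plus sign before \<open>r\<close> in \<open>Q\<close>.\<close>
  define q where "q i = 2 * fact n * (- 1) ^ i / fact i * (p (2 * n - i) / fact (n - i))" for i
  define r :: complex where "r = fact n ^ 2 / fact (2 * n + 1)"
  define Q where "Q = D n ^ 2 - (\<Sum>i\<le>n. fls_const (q i) * D i) + fls_const r * D (2 * n + 1)"
  have sgn: "(- 1) ^ n = (1 :: complex)" using assms by simp
  have sq: "fls_nth (D n ^ 2) k = (if k = - 2 * int n - 2 then (fact n) ^ 2 else 0) +
     2 * fact n * fls_nth (fps_to_fls (bernoulli_tail n)) (k + int n + 1) +
     fls_nth (fps_to_fls (bernoulli_tail n ^ 2)) k" for k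
    unfolding D_def exp_pole_deriv_iter_squared_nth sgn by simp
  have Qn: "fls_nth Q k = fls_nth (D n ^ 2) k - (\<Sum>i\<le>n. q i * fls_nth (D i) k) + r * fls_nth (D (2 * n + 1)) k" for k
    by (simp add: Q_def fls_nth_sum)
  have "Q = 0"
  proof (rule exp_pole_ideal_eq_0)
    show "Q \<in> exp_pole_ideal"
      unfolding Q_def D_def power2_eq_square
      by (intro exp_pole_ideal.add exp_pole_ideal_diff exp_pole_ideal_sum exp_pole_ideal.scale
          exp_pole_ideal_mult exp_pole_ideal_deriv_iter)
    fix k :: int assume "k < 0"
    define i where "i = nat (- k - 1)"
    have k: "k = - int i - 1" using \<open>k < 0\<close> by (simp add: i_def)
    have "(\<Sum>l\<le>n. q l * fls_nth (D l) k) = (\<Sum>l\<le>n. if l = i then q i * ((- 1) ^ i * fact i) else 0)"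
      unfolding k D_def exp_pole_deriv_iter_nth_neg by (intro sum.cong) auto
    also have "\<dots> = (if i \<le> n then q i * ((- 1) ^ i * fact i) else 0)" by simp
    also have "\<dots> = (if i \<le> n then 2 * fact n * (p (2 * n - i) / fact (n - i)) else 0)"
      by (simp add: q_def flip: power_add mult_2)
    finally have 1: "(\<Sum>l\<le>n. q l * fls_nth (D l) k) = \<dots>" .
    have 2: "r * fls_nth (D (2 * n + 1)) k = (if i = 2 * n + 1 then - (fact n ^ 2) else 0)"
      unfolding k D_def exp_pole_deriv_iter_nth_neg by (simp add: r_def del: fact_Suc)
    have 3: "fls_nth (fps_to_fls (bernoulli_tail n)) (k + int n + 1) = (if i \<le> n then p (2 * n - i) / fact (n - i) else 0)"
    proof (cases "i \<le> n")
      case True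
      define l where "l = n - i"
      have 4: "k + int n + 1 = int l" "2 * n - i = n + l" using True by (auto simp: k l_def)
      show ?thesis unfolding 4 l_def[symmetric] using True by (simp add: p_def)
    qed (simp add: k)
    show "fls_nth Q k = 0"
      unfolding Qn 1 2 sq 3 by (auto simp: k)
  qed
  hence "fls_nth Q (int n) = 0" by simp
  hence eq: "2 * fact n * (p (3 * n + 1) / fact (2 * n + 1)) + fps_nth (bernoulli_tail n ^ 2) n -
      (\<Sum>i\<le>n. q i * (p (i + n) / fact n)) + r * (p (3 * n + 1) / fact n) = 0"
  proof -
    have T: "fls_nth (fps_to_fls f) (int k) = fps_nth f k" for f :: "complex fps" and k
      by simp
    have idx: "int n + int n + 1 = int (2 * n + 1)" "n + (2 * n + 1) = 3 * n + 1" "2 * n + 1 + n = 3 * n + 1"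
      and cond: "(int n = - 2 * int n - 2) = False" by auto
    have Dn: "fls_nth (D l) (int n) = p (l + n) / fact n" for l
      unfolding D_def exp_pole_deriv_iter_nth_nonneg p_def ..
    from \<open>fls_nth Q (int n) = 0\<close> show ?thesis
      unfolding Qn sq idx T Dn cond if_False bernoulli_tail_nth p_def[symmetric] add_0 .
  qed
  have binom: "of_nat (n choose i) = (fact n / (fact i * fact (n - i)) :: complex)" if "i \<le> n" for i
    using that by (rule binomial_fact)
  have S1: "fact n * fps_nth (bernoulli_tail n ^ 2) n = (\<Sum>i\<le>n. of_nat (n choose i) * (p (n + i) * p (2 * n - i)))"
    unfolding power2_eq_square fps_mult_nth sum_distrib_left atMost_atLeast0
  proof (intro sum.cong refl)
    fix i assume "i \<in> {0..n}"
    hence i: "i \<le> n" "n + (n - i) = 2 * n - i" by auto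
    show "fact n * (fps_nth (bernoulli_tail n) i * fps_nth (bernoulli_tail n) (n - i)) =
        of_nat (n choose i) * (p (n + i) * p (2 * n - i))"
      using i by (simp add: binom p_def)
  qed
  have S2: "fact n * (\<Sum>i\<le>n. q i * (p (i + n) / fact n)) =
      2 * (\<Sum>i\<le>n. (- 1) ^ i * (of_nat (n choose i) * (p (n + i) * p (2 * n - i))))"
    unfolding sum_distrib_left
    by (intro sum.cong refl) (simp add: binom q_def add.commute)
  have "fact n * (2 * fact n * (p (3 * n + 1) / fact (2 * n + 1)) + fps_nth (bernoulli_tail n ^ 2) n -
      (\<Sum>i\<le>n. q i * (p (i + n) / fact n)) + r * (p (3 * n + 1) / fact n)) = 0"
    unfolding eq by simp
  hence "2 * (fact n ^ 2 / fact (2 * n + 1) * p (3 * n + 1)) + fact n * fps_nth (bernoulli_tail n ^ 2) n -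
      fact n * (\<Sum>i\<le>n. q i * (p (i + n) / fact n)) + r * p (3 * n + 1) = 0"
    by (simp add: ring_distribs power2_eq_square mult_ac del: fact_Suc)
  thus ?thesis unfolding S1 S2 r_def by (simp add: algebra_simps del: fact_Suc)
qed

text \<open>For even \<open>n\<close> only odd \<open>i\<close> contribute, so the alternating sum
  is \<open>- V\<close> and the identity becomes \<open>3 (U + V) = 0\<close>. For odd
  \<open>n\<close> the index \<open>3 n + 1\<close> is even, and the indices \<open>n + i\<close>
  and \<open>2 n - i\<close> have odd sum, so one of them is even. As \<open>n > 0\<close>, all
  these indices are positive.\<close>

lemma bernoulli_deriv_value:
  fixes n :: nat
  defines "p \<equiv> bernoulli_deriv"
  assumes "n > 0"
  shows "fact n ^ 2 / fact (2 * n + 1) * p (3 * n + 1) +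
    (- 1) ^ n * (\<Sum>i\<le>n. of_nat (n choose i) * (p (n + i) * p (2 * n - i))) = 0"
proof (cases "even n")
  case True
  define U V where "U = fact n ^ 2 / fact (2 * n + 1) * p (3 * n + 1)"
    and "V = (\<Sum>i\<le>n. of_nat (n choose i) * (p (n + i) * p (2 * n - i)))"
  have "(\<Sum>i\<le>n. (- 1) ^ i * (of_nat (n choose i) * (p (n + i) * p (2 * n - i)))) =
      (\<Sum>i\<le>n. - (of_nat (n choose i) * (p (n + i) * p (2 * n - i))))"
  proof (intro sum.cong refl)
    fix i
    have "even i \<Longrightarrow> p (n + i) = 0"
      unfolding p_def using True assms(2) by (intro bernoulli_deriv_even) auto
    thus "(- 1) ^ i * (of_nat (n choose i) * (p (n + i) * p (2 * n - i))) =
        - (of_nat (n choose i) * (p (n + i) * p (2 * n - i)))"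
      by (cases "even i") auto
  qed
  hence "(\<Sum>i\<le>n. (- 1) ^ i * (of_nat (n choose i) * (p (n + i) * p (2 * n - i)))) = - V"
    by (simp add: V_def sum_negf)
  with bernoulli_deriv_identity[OF True, folded p_def, folded U_def V_def]
  have "2 * U + V = - U + 2 * (- V)" by simp
  hence "3 * (U + V) = 0" by (simp add: algebra_simps)
  hence "U + V = 0" by (simp only: mult_eq_0_iff) simp
  moreover have "(- 1) ^ n = (1 :: complex)" using True by simp
  ultimately show ?thesis by (simp only: U_def V_def mult_1_left)
next
  case False
  have "p (3 * n + 1) = 0"
    unfolding p_def using False by (intro bernoulli_deriv_even) auto
  moreover have "p (n + i) * p (2 * n - i) = 0" if "i \<le> n" for i
  proof (cases "even (n + i)")
    case True
    thus ?thesis unfolding p_def using assms(2) bernoulli_deriv_even[of "n + i"] by simp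
  next
    case odd: False
    hence "even (2 * n - i)" using False that by auto
    thus ?thesis unfolding p_def using assms(2) that bernoulli_deriv_even[of "2 * n - i"] by simp
  qed
  hence "(\<Sum>i\<le>n. of_nat (n choose i) * (p (n + i) * p (2 * n - i))) = 0"
    by (intro sum.neutral) auto
  ultimately show ?thesis by simp
qed

section \<open>Values at the nonpositive integers\<close>

text \<open>The identity theorem gives equality off a sparse set. It extends to every point because
  a nicely meromorphic function coincides with its own \<open>remove_sings\<close>, which depends
  only on values in a punctured neighbourhood.\<close>

lemma nicely_meromorphic_on_UNIV_eqI:
  assumes f: "f nicely_meromorphic_on UNIV" and g: "g nicely_meromorphic_on UNIV"
    and U: "open U" "U \<noteq> {}" and eq: "\<And>z. z \<in> U \<Longrightarrow> f z = g z"
  shows "f = g"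
proof
  fix z
  have rs: "remove_sings h z = h z" if "h nicely_meromorphic_on UNIV" for h :: "complex \<Rightarrow> complex"
  proof (cases "is_pole h z \<and> h z = 0")
    case False
    hence "h \<midarrow>z\<rightarrow> h z" using that by (auto simp: nicely_meromorphic_on_def)
    thus ?thesis by (rule remove_sings_eqI)
  qed simp
  have "(\<lambda>z. f z - g z) meromorphic_on UNIV"
    using f g by (intro meromorphic_intros) (auto simp: nicely_meromorphic_on_def)
  hence "eventually (\<lambda>z. f z - g z = 0) (cosparse UNIV) \<or> eventually (\<lambda>z. f z - g z \<noteq> 0) (cosparse UNIV)"
    by (rule meromorphic_imp_constant_or_avoid) auto
  moreover have "\<not> eventually (\<lambda>z. f z - g z \<noteq> 0) (cosparse UNIV)"
  proof
    assume ev: "eventually (\<lambda>z. f z - g z \<noteq> 0) (cosparse UNIV)"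
    obtain u where u: "u \<in> U" using U by blast
    have "eventually (\<lambda>z. f z - g z \<noteq> 0) (at u)"
      using ev by (simp add: eventually_cosparse_open_eq)
    moreover have "eventually (\<lambda>z. z \<in> U) (at u)"
      using U(1) u by (intro eventually_at_in_open') auto
    ultimately have "eventually (\<lambda>z. False) (at u)"
      by eventually_elim (use eq in auto)
    thus False by simp
  qed
  ultimately have "eventually (\<lambda>z. f z - g z = 0) (cosparse UNIV)" by blast
  hence "eventually (\<lambda>w. f w = g w) (at z)"
    by (simp add: eventually_cosparse_open_eq)
  hence "remove_sings f z = remove_sings g z"
    by (rule remove_sings_cong) simp
  thus "f z = g z" using rs[OF f] rs[OF g] by simp
qed

section \<open>Evaluation at \<open>s = -n\<close>\<close>

lemma reg_chain_neg_nat: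
  assumes "x > 0"
  shows "reg_chain (- of_nat n) m x = (- 1) ^ n * (deriv ^^ (n + m)) bernoulli_fun (of_real x)"
proof -
  have "- of_nat n - of_nat m = - (of_nat (n + m) :: complex)" by simp
  moreover have "(- 1) ^ m * (- 1) ^ (n + m) = ((- 1) ^ n :: complex)"
    by (simp add: power_add mult_ac flip: power_mult_distrib)
  ultimately show ?thesis
    unfolding reg_chain_def polylog_reg_neg_nat[OF assms, of "n + m", symmetric]
    using polylog_reg_neg_nat[OF assms, of "n + m"] by (simp flip: mult.assoc)
qed

lemma regularized_moment_reg_chain_neg_nat:
  "regularized_moment (Suc m) (- of_nat m) (reg_chain (- of_nat n)) =
     (- 1) ^ m * ((- 1) ^ n * bernoulli_deriv (n + m))"
proof -
  have "regularized_moment (Suc m) (- of_nat m) (reg_chain (- of_nat n)) =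
      (- 1) ^ m * ((- 1) ^ n * (deriv ^^ (n + m)) bernoulli_fun (of_real 0))"
  proof (rule regularized_moment_neg_nat)
    show "deriv_chain (reg_chain (- of_nat n))" by (rule deriv_chain_reg) simp
    show "continuous_on {0..1} (\<lambda>x. (- 1) ^ n * (deriv ^^ (n + m)) bernoulli_fun (of_real x))"
      by (intro continuous_on_mult_left continuous_on_higher_deriv_bernoulli_fun)
  qed (rule reg_chain_neg_nat)
  thus ?thesis by (simp add: bernoulli_deriv_def)
qed

lemma regularized_moment_sq_chain_neg_nat:
  "regularized_moment (Suc n) (- of_nat n) (sq_chain (- of_nat n)) =
     (- 1) ^ n * (\<Sum>i\<le>n. of_nat (n choose i) * (bernoulli_deriv (n + i) * bernoulli_deriv (2 * n - i)))"
proof -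
  define g where "g x = (\<Sum>i\<le>n. of_nat (n choose i) *
    ((deriv ^^ (n + i)) bernoulli_fun (of_real x) * (deriv ^^ (2 * n - i)) bernoulli_fun (of_real x)))" for x
  have "regularized_moment (Suc n) (- of_nat n) (sq_chain (- of_nat n)) = (- 1) ^ n * g 0"
  proof (rule regularized_moment_neg_nat)
    show "deriv_chain (sq_chain (- of_nat n))" by (intro deriv_chain_prod deriv_chain_reg) simp_all
    show "continuous_on {0..1} g"
      unfolding g_def by (intro continuous_on_sum continuous_on_mult continuous_on_const
          continuous_on_higher_deriv_bernoulli_fun)
    fix x :: real assume x: "0 < x"
    show "sq_chain (- of_nat n) n x = g x"
      unfolding prod_chain_def g_def
    proof (intro sum.cong refl)
      fix i assume "i \<in> {..n}"
      hence idx: "n + (n - i) = 2 * n - i" by auto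
      have "((- 1) ^ n * a) * ((- 1) ^ n * b) = a * b" for a b :: complex
        by (simp flip: power_mult_distrib)
      thus "of_nat (n choose i) * (reg_chain (- of_nat n) i x * reg_chain (- of_nat n) (n - i) x) =
          of_nat (n choose i) *
          ((deriv ^^ (n + i)) bernoulli_fun (of_real x) * (deriv ^^ (2 * n - i)) bernoulli_fun (of_real x))"
        by (simp only: reg_chain_neg_nat[OF x] idx)
    qed
  qed
  thus ?thesis by (simp add: g_def bernoulli_deriv_def)
qed

lemma not_nonpos_Int_half: "- of_nat n - 1 / 2 \<notin> (\<int>\<^sub>\<le>\<^sub>0 :: complex set)"
proof
  assume "- of_nat n - 1 / 2 \<in> (\<int>\<^sub>\<le>\<^sub>0 :: complex set)"
  then obtain m :: int where "- of_nat n - 1 / 2 = (of_int m :: complex)"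
    by (elim nonpos_Ints_cases) blast
  from arg_cong[OF this, of Re] have "real_of_int (2 * m) = real_of_int (- 2 * int n - 1)" by simp
  hence "2 * m = - 2 * int n - 1" by (simp only: of_int_eq_iff)
  thus False by presburger
qed

text \<open>By duplication the left side is the limit of \<open>Gamma (2 s - 1) / Gamma s\<close> at
  \<open>s = -n\<close>, a quotient of residues: \<open>- 1 / (2 n + 1)!\<close> over
  \<open>(- 1) ^ n / n!\<close>, with a further \<open>1 / 2\<close> from the inner derivative of
  \<open>2 s - 1\<close>. The induction uses the functional equation of \<open>Gamma\<close> instead
  of limits.\<close>

lemma dupl_factor_neg_nat:
  "dupl_factor (- of_nat n) * Gamma (- of_nat n - 1 / 2) = (- 1) ^ Suc n * fact n / (2 * fact (2 * n + 1))"
proof (induction n)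
  case 0
  have "Gamma (- 1 / 2 + 1) = (- 1 / 2) * Gamma (- 1 / 2 :: complex)"
    using not_nonpos_Int_half[of 0] by (intro Gamma_plus1) simp
  hence "Gamma (- 1 / 2 :: complex) = - 2 * of_real (sqrt pi)"
    by (simp add: Gamma_one_half_complex)
  moreover have "exp (- 2 * complex_of_real (ln 2)) = of_real (1 / 4)"
    using exp_of_nat_mult[of 2 "complex_of_real (ln 2)"]
    by (simp add: exp_minus exp_of_real)
  ultimately show ?case by (simp add: dupl_factor_def mult.commute[of 4])
next
  case (Suc n)
  define a :: complex where "a = - of_nat (Suc n) - 1 / 2"
  have a1: "a + 1 = - of_nat n - 1 / 2" by (simp add: a_def)
  have a0: "a \<noteq> 0" using not_nonpos_Int_half[of "Suc n"] by (auto simp: a_def)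
  have "Gamma (a + 1) = a * Gamma a"
    unfolding a_def by (intro Gamma_plus1 not_nonpos_Int_half)
  hence G: "Gamma a = Gamma (- of_nat n - 1 / 2) / a" using a0 unfolding a1 by simp
  have df: "dupl_factor (- of_nat (Suc n)) = dupl_factor (- of_nat n) / 4"
  proof -
    have "(2 * - of_nat (Suc n) - 2) * of_real (ln 2) =
        (2 * - of_nat n - 2) * of_real (ln 2) - 2 * complex_of_real (ln 2)"
      by (simp add: algebra_simps)
    moreover have "exp (2 * complex_of_real (ln 2)) = 4"
      using exp_of_nat_mult[of 2 "complex_of_real (ln 2)"] by (simp add: exp_of_real)
    ultimately show ?thesis unfolding dupl_factor_def by (simp add: exp_diff)
  qed
  have "dupl_factor (- of_nat (Suc n)) * Gamma a =
      dupl_factor (- of_nat n) * Gamma (- of_nat n - 1 / 2) / (4 * a)"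
    unfolding df G by simp
  also have "\<dots> = (- 1) ^ Suc n * fact n / (2 * fact (2 * n + 1)) / (4 * a)"
    by (simp only: Suc)
  also have "\<dots> = (- 1) ^ Suc (Suc n) * fact (Suc n) / (2 * fact (2 * Suc n + 1))"
  proof -
    have f1: "fact (2 * Suc n + 1) = (2 * of_nat n + 3) * (2 * (of_nat n + 1)) * (fact (2 * n + 1) :: complex)"
      by (simp add: algebra_simps)
    have f2: "fact (Suc n) = (of_nat n + 1) * (fact n :: complex)"
      by (simp add: algebra_simps)
    have f3: "4 * a = - (2 * (2 * of_nat n + 3))"
      by (simp add: a_def algebra_simps)
    have "of_nat n + 1 \<noteq> (0 :: complex)" "2 * of_nat n + 3 \<noteq> (0 :: complex)"
      by (metis of_nat_Suc of_nat_eq_0_iff add.commute nat.distinct(1))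
         (use of_nat_eq_0_iff[of "2 * n + 3", where 'a = complex] in simp)
    moreover have "e * f / (2 * g) / - (2 * y) = - 1 * e * (x * f) / (2 * (y * (2 * x) * g))"
      if "x \<noteq> 0" "y \<noteq> 0" "g \<noteq> 0" for e f g x y :: complex
      using that by (simp add: field_simps)
    ultimately show ?thesis
      unfolding f1 f2 f3 power_Suc[of _ "Suc n"] by (metis fact_nonzero)
  qed
  finally show ?case unfolding a_def .
qed

text \<open>Since \<open>rGamma s = 0\<close>, the pure power and the tail drop out. The two
  regularized moments remain because each already contains its \<open>rGamma\<close> factor, whose
  zero was absorbed by a pole of the moment. The depth is \<open>n + 1\<close> because
  \<open>- M < Re s\<close> is strict.\<close>

lemma omega_numerator_neg_nat:
  fixes n :: nat
  defines "s \<equiv> - of_nat n :: complex" and "p \<equiv> bernoulli_deriv"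
  shows "omega_numerator (Suc n) s = (3 * s - 2) * rGamma (s - 1 / 2) *
    (fact n ^ 2 / fact (2 * n + 1) * p (3 * n + 1) +
     (- 1) ^ n * (\<Sum>i\<le>n. of_nat (n choose i) * (p (n + i) * p (2 * n - i))))"
proof -
  define V where "V = (- 1) ^ n * (\<Sum>i\<le>n. of_nat (n choose i) * (p (n + i) * p (2 * n - i)))"
  define U where "U = fact n ^ 2 / fact (2 * n + 1) * p (3 * n + 1)"
  have K1: "regularized_moment (Suc n) s (sq_chain s) = V"
    unfolding s_def V_def p_def by (rule regularized_moment_sq_chain_neg_nat)
  have idx: "2 * Suc n + 1 = Suc (Suc (2 * n + 1))" "n + (2 * n + 1) = 3 * n + 1" by simp_all
  have s2: "2 * s - 1 = - of_nat (2 * n + 1)" by (simp add: s_def)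
  have "deriv_chain (reg_chain s)" by (rule deriv_chain_reg) (simp add: s_def)
  \<comment> \<open>The depth \<open>2 n + 3\<close> is one more than the evaluation at
    \<open>2 s - 1 = - (2 n + 1)\<close> calls for; independence of the depth removes the
    excess.\<close>
  hence "regularized_moment (2 * Suc n + 1) (2 * s - 1) (reg_chain s) =
      regularized_moment (Suc (2 * n + 1)) (2 * s - 1) (reg_chain s)"
    unfolding idx by (rule regularized_moment_Suc) (simp add: s_def)
  also have "\<dots> = (- 1) ^ (2 * n + 1) * ((- 1) ^ n * p (3 * n + 1))"
    unfolding s2 unfolding s_def regularized_moment_reg_chain_neg_nat idx p_def ..
  also have "\<dots> = (- 1) ^ Suc n * p (3 * n + 1)" by simp
  finally have K2: "regularized_moment (2 * Suc n + 1) (2 * s - 1) (reg_chain s) = (- 1) ^ Suc n * p (3 * n + 1)" .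
  have G1: "Gamma (1 - s) = fact n" by (simp add: s_def Gamma_fact)
  have "rGamma (s - 1 / 2) * Gamma (s - 1 / 2) = 1"
    using not_nonpos_Int_half[of n] by (simp add: s_def rGamma_inverse_Gamma Gamma_eq_zero_iff)
  hence "dupl_factor s = rGamma (s - 1 / 2) * (dupl_factor s * Gamma (s - 1 / 2))"
    by (simp add: mult_ac)
  also have "dupl_factor s * Gamma (s - 1 / 2) = (- 1) ^ Suc n * fact n / (2 * fact (2 * n + 1))"
    unfolding s_def by (rule dupl_factor_neg_nat)
  finally have df: "dupl_factor s = rGamma (s - 1 / 2) * ((- 1) ^ Suc n * fact n / (2 * fact (2 * n + 1)))" .
  have r0: "rGamma s = 0" by (simp add: s_def rGamma_eq_zero_iff)
  have "2 * f * (r * (e * f / (2 * d))) * (e * q) = r * ((e * e) * (f ^ 2 / d * q))" for f r e d q :: complex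
    by (simp add: power2_eq_square)
  from this[of "fact n" "rGamma (s - 1 / 2)" "(- 1) ^ Suc n" "fact (2 * n + 1)" "p (3 * n + 1)"]
  have eq: "2 * fact n * dupl_factor s * ((- 1) ^ Suc n * p (3 * n + 1)) = rGamma (s - 1 / 2) * U"
    unfolding df U_def by (simp flip: power_mult_distrib del: fact_Suc)
  show ?thesis
    unfolding omega_numerator_def K1 K2 G1 r0 eq V_def[symmetric] U_def[symmetric]
    by (simp add: algebra_simps)
qed

lemma omega_continuation:
  obtains \<omega> where "is_omega \<omega>" and "\<And>n :: nat. \<omega> analytic_on {- of_nat n}"
    and "\<omega> 0 = 1 / 3" and "\<And>n :: nat. n \<ge> 1 \<Longrightarrow> \<omega> (- of_nat n) = 0"
proof -
  obtain H where H: "H holomorphic_on UNIV"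
    and H1: "\<And>s. Re s > 2 / 3 \<Longrightarrow> H s = (3 * s - 2) * rGamma (s - 1 / 2) * omega_series s"
    and H2: "\<And>M s. - real M < Re s \<Longrightarrow> Re s < 1 \<Longrightarrow> H s = omega_numerator M s"
    using omega_numerator_entire by blast
  define d where "d s = (3 * s - 2) * rGamma (s - 1 / 2)" for s :: complex
  define f where "f s = H s / d s" for s
  \<comment> \<open>At zeros of \<open>d\<close> the quotient has the default value
    \<open>0\<close>. Passing to \<open>remove_sings\<close> restores the limit where there is one
    and keeps \<open>0\<close> at poles, as \<open>is_omega\<close> demands.\<close>
  define \<omega> where "\<omega> = remove_sings f"
  have d: "d holomorphic_on UNIV" unfolding d_def by (intro holomorphic_intros)
  have Hd: "H analytic_on UNIV" "d analytic_on UNIV"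
    using H d by (simp_all add: analytic_on_open)
  have mero: "f meromorphic_on UNIV"
    unfolding f_def using Hd by (intro meromorphic_intros analytic_on_imp_meromorphic_on)
  have an: "f analytic_on {s}" if "d s \<noteq> 0" for s
    unfolding f_def using Hd that
    by (intro analytic_on_divide) (auto intro: analytic_on_subset)
  have val: "\<omega> s = H s / d s" if "d s \<noteq> 0" for s
    using an[OF that] by (simp add: \<omega>_def f_def)
  have om_an: "\<omega> analytic_on {s}" if "d s \<noteq> 0" for s
    unfolding \<omega>_def using an[OF that] by (rule remove_sings_analytic_on)
  have d_right: "d s \<noteq> 0" if "Re s > 2 / 3" for s
  proof -
    have "3 * s - 2 \<noteq> 0" using that by (auto simp: complex_eq_iff)
    moreover have "s - 1 / 2 \<notin> \<int>\<^sub>\<le>\<^sub>0" using that by (intro not_nonpos_Int_if_Re_pos) simp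
    ultimately show ?thesis by (simp add: d_def rGamma_eq_zero_iff)
  qed
  have d_neg: "d (- of_nat n) \<noteq> 0" for n :: nat
  proof -
    have "3 * - of_nat n - 2 \<noteq> (0 :: complex)"
    proof
      assume "3 * - of_nat n - 2 = (0 :: complex)"
      from arg_cong[OF this, of Re] show False by simp
    qed
    thus ?thesis using not_nonpos_Int_half[of n] by (simp add: d_def rGamma_eq_zero_iff)
  qed
  have neg: "\<omega> (- of_nat n) = fact n ^ 2 / fact (2 * n + 1) * bernoulli_deriv (3 * n + 1) +
     (- 1) ^ n * (\<Sum>i\<le>n. of_nat (n choose i) * (bernoulli_deriv (n + i) * bernoulli_deriv (2 * n - i)))" for n
  proof -
    have "H (- of_nat n) = omega_numerator (Suc n) (- of_nat n)" by (intro H2) auto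
    thus ?thesis
      using d_neg[of n] unfolding val[OF d_neg] omega_numerator_neg_nat d_def by (simp del: fact_Suc)
  qed
  show thesis
  proof (rule that)
    show "is_omega \<omega>"
      unfolding is_omega_def
    proof (intro conjI allI impI)
      show "\<omega> nicely_meromorphic_on UNIV"
        unfolding \<omega>_def by (rule remove_sings_nicely_meromorphic[OF mero])
      show "\<omega> s = omega_series s" if "Re s > 2 / 3" for s
        using d_right[OF that] val[OF d_right[OF that]] H1[OF that] by (simp add: d_def)
    qed
    show "\<omega> analytic_on {- of_nat n}" for n :: nat
      by (rule om_an[OF d_neg])
    \<comment> \<open>The two contributions are \<open>p 1 = 1 / 12\<close> and
      \<open>p 0 ^ 2 = 1 / 4\<close>.\<close>
    show "\<omega> 0 = 1 / 3"
      using neg[of 0] by (simp add: bernoulli_deriv_0 bernoulli_deriv_1[unfolded One_nat_def])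
    show "\<omega> (- of_nat n) = 0" if "n \<ge> 1" for n :: nat
      unfolding neg using that by (intro bernoulli_deriv_value) simp
  qed
qed

theorem theorem1p3:
  shows "(\<forall>s. Re s > 2 / 3 \<longrightarrow> omega_term s summable_on ({1..} \<times> {1..})) \<and>
    (\<exists>!\<omega>. is_omega \<omega>) \<and>
    (\<forall>\<omega>. is_omega \<omega> \<longrightarrow>
       (\<forall>n::nat. \<omega> analytic_on {- of_nat n}) \<and>
       \<omega> 0 = 1 / 3 \<and>
       (\<forall>n::nat. n \<ge> 1 \<longrightarrow> \<omega> (- of_nat n) = 0))"
proof -
  obtain \<omega> where \<omega>: "is_omega \<omega>" "\<And>n :: nat. \<omega> analytic_on {- of_nat n}"
    "\<omega> 0 = 1 / 3" "\<And>n :: nat. n \<ge> 1 \<Longrightarrow> \<omega> (- of_nat n) = 0"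
    using omega_continuation by blast
  have unique: "\<omega>' = \<omega>" if "is_omega \<omega>'" for \<omega>'
  proof (rule nicely_meromorphic_on_UNIV_eqI)
    show "open {s. Re s > 2 / 3}" by (rule open_halfspace_Re_gt)
    show "{s. Re s > 2 / 3} \<noteq> {}" by (auto intro!: exI[of _ 1])
  qed (use that \<omega>(1) in \<open>auto simp: is_omega_def\<close>)
  have "\<forall>s. Re s > 2 / 3 \<longrightarrow> omega_term s summable_on ({1..} \<times> {1..})"
    using summable_on_omega_term unfolding pair_indices_def by blast
  moreover have "\<exists>!\<omega>. is_omega \<omega>"
    using \<omega>(1) unique by blast
  moreover have "\<forall>\<omega>'. is_omega \<omega>' \<longrightarrow> (\<forall>n::nat. \<omega>' analytic_on {- of_nat n}) \<and>
      \<omega>' 0 = 1 / 3 \<and> (\<forall>n::nat. n \<ge> 1 \<longrightarrow> \<omega>' (- of_nat n) = 0)"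
    using unique \<omega> by blast
  ultimately show ?thesis by blast
qed

end
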